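(* The strong USP capacity is at least $2^{2/3}$, and the exponent $\omega$ of matrix multiplication over $\mathbb{C}$ satisfies $\omega<2.48$.
   Context: The exponent of matrix multiplication $\omega$ (over $\mathbb{C}$) is the smallest real number such that, for each $\varepsilon>0$, $n\times n$ matrix multiplication over $\mathbb{C}$ can be performed in $O(n^{\omega+\varepsilon})$ arithmetic operations. $[k]=\{1,\dots,k\}$ and $\mathrm{Sym}(U)$ is the group of permutations of the set $U$. A strong USP (strong uniquely solvable puzzle) of width $k$ is a subset $U\subseteq\{1,2,3\}^k$ such that for all $\pi_1,\pi_2,\pi_3\in\mathrm{Sym}(U)$, either $\pi_1=\pi_2=\pi_3$ or else there exist $u\in U$ and $i\in[k]$ such that exactly two of $(\pi_1(u))_i=1$, $(\pi_2(u))_i=2$, $(\pi_3(u))_i=3$ hold. The strong USP capacity is the largest constant $C$ such that there exist strong USPs of size $(C-o(1))^k$ and width $k$ for infinitely many values of $k$. *)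

theory Defs
  imports
    Complex_Main
    "HOL-Library.Landau_Symbols"
    "HOL-Library.FuncSet"
    "HOL-Combinatorics.Permutations"
    "Jordan_Normal_Form.Matrix"
begin

section \<open>Strong uniquely solvable puzzles\<close>

text \<open>Words in \<open>{1,2,3}\<^sup>k\<close> are extensional functions on \<open>{1..k}\<close>.\<close>

definition strong_USP :: "nat \<Rightarrow> (nat \<Rightarrow> nat) set \<Rightarrow> bool" where
  "strong_USP k U \<longleftrightarrow>
     U \<subseteq> ({1..k} \<rightarrow>\<^sub>E {1, 2, 3}) \<and>
     (\<forall>\<pi>1 \<pi>2 \<pi>3. \<pi>1 permutes U \<longrightarrow> \<pi>2 permutes U \<longrightarrow> \<pi>3 permutes U \<longrightarrow>
        (\<pi>1 = \<pi>2 \<and> \<pi>2 = \<pi>3) \<or>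
        (\<exists>u\<in>U. \<exists>i\<in>{1..k}.
           of_bool (\<pi>1 u i = 1) + of_bool (\<pi>2 u i = 2) + of_bool (\<pi>3 u i = 3) = (2::nat)))"

definition strong_USP_capacity :: real where
  "strong_USP_capacity =
     (GREATEST C. \<exists>\<delta> :: nat \<Rightarrow> real. \<delta> \<in> o(\<lambda>_. 1) \<and>
        infinite {k. \<exists>U. strong_USP k U \<and> real (card U) = (C - \<delta> k) ^ k})"

section \<open>Arithmetic complexity of matrix multiplication\<close>

text \<open>
  Algorithms are straight-line programs over the complex numbers. Operands are constants (free of
  charge), entries of the two input matrices, and results of earlier instructions, numbered from 0;
  each instruction is one arithmetic operation. Execution fails (\<^term>\<open>None\<close>) on a division by zero
  or a reference to a nonexistent entry or result.
\<close>

datatype operand = Const complex | Left_Entry nat nat | Right_Entry nat nat | Result nat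

datatype arith_op = Plus | Minus | Times | Divide

type_synonym instruction = "arith_op \<times> operand \<times> operand"

fun operand_value :: "complex mat \<Rightarrow> complex mat \<Rightarrow> complex list \<Rightarrow> operand \<Rightarrow> complex option" where
  "operand_value A B vs (Const c) = Some c"
| "operand_value A B vs (Left_Entry i j) =
     (if i < dim_row A \<and> j < dim_col A then Some (A $$ (i, j)) else None)"
| "operand_value A B vs (Right_Entry i j) =
     (if i < dim_row B \<and> j < dim_col B then Some (B $$ (i, j)) else None)"
| "operand_value A B vs (Result r) = (if r < length vs then Some (vs ! r) else None)"

fun apply_op :: "arith_op \<Rightarrow> complex \<Rightarrow> complex \<Rightarrow> complex option" where
  "apply_op Plus x y = Some (x + y)"
| "apply_op Minus x y = Some (x - y)"
| "apply_op Times x y = Some (x * y)"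
| "apply_op Divide x y = (if y = 0 then None else Some (x / y))"

fun run :: "complex mat \<Rightarrow> complex mat \<Rightarrow> instruction list \<Rightarrow> complex list \<Rightarrow> complex list option" where
  "run A B [] vs = Some vs"
| "run A B ((f, p, q) # prog) vs =
     Option.bind (operand_value A B vs p) (\<lambda>x.
     Option.bind (operand_value A B vs q) (\<lambda>y.
     Option.bind (apply_op f x y) (\<lambda>z. run A B prog (vs @ [z]))))"

definition computes_matrix_product ::
    "nat \<Rightarrow> instruction list \<Rightarrow> (nat \<Rightarrow> nat \<Rightarrow> operand) \<Rightarrow> bool" where
  "computes_matrix_product n prog out \<longleftrightarrow>
     (\<forall>A\<in>carrier_mat n n. \<forall>B\<in>carrier_mat n n. \<exists>vs.
        run A B prog [] = Some vs \<and>
        (\<forall>i<n. \<forall>j<n. operand_value A B vs (out i j) = Some ((A * B) $$ (i, j))))"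

definition matrix_mult_in_ops :: "nat \<Rightarrow> nat \<Rightarrow> bool" where
  "matrix_mult_in_ops n m \<longleftrightarrow>
     (\<exists>prog out. length prog = m \<and> computes_matrix_product n prog out)"

definition matrix_mult_exponent :: real where
  "matrix_mult_exponent =
     (LEAST w. \<forall>\<epsilon>>0. \<exists>ops :: nat \<Rightarrow> nat.
        (\<forall>n. matrix_mult_in_ops n (ops n)) \<and>
        (\<lambda>n. real (ops n)) \<in> O(\<lambda>n. real n powr (w + \<epsilon>)))"

end

(*
  The triples (a, b, c) with a + b + c = 2^K - 1, written in binary with one alphabet {1,2}, {2,3},
  {3,1} per coordinate, form a strong USP: if three permutations violate the defining condition, then
  they agree pairwise in one coordinate each, and a sum of squares shows that they are equal. There
  are about 4^K / 2 triples and the width is 3 K, whence the capacity bound.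

  The |U|! permutations of a strong USP U of width k, each read as a word on U x {1..k}, give as many
  independent products of matrices of size (m - 1)^D inside the algebra of the group (Z/m)^(|U| k),
  where D is the number of occurrences of each letter. This algebra is diagonalised by characters,
  so r = |U|! products cost R = m^(|U| k) multiplications. Recursing on blocks, with the R products
  arranged in batches of r, gives the exponent log (R / r) / log N, N = (m - 1)^D. With m = 6 and the
  puzzle above this tends to log 54 / log 5 = 2.4785, which is less than 119 / 48.
*)
theory Submission
  imports
    Defs
    "HOL-Library.Function_Algebras"
    "HOL-Library.Nat_Bijection"
    "HOL-Analysis.Extended_Real_Limits"
begin

section \<open>Straight-line derivations in a ring\<close>

text \<open>The recursion takes the place of the asymptotic sum inequality. Because every letter
  occurs equally often in the puzzle, all \<open>r\<close> products have one common size
  \<open>N\<close>, so a single fixed algorithm can be iterated: \<open>r\<close> products of size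
  \<open>N * M\<close> cost \<open>\<rho>\<close> batches of \<open>r\<close> products of size
  \<open>M\<close>, plus linear work of order \<open>M^2\<close>. Since \<rho> > N^2, the linear
  work is absorbed and the cost at size \<open>N^s\<close> is of order \<open>\<rho>^s\<close>. No
  limit over algorithms is taken. As 119 / 48 lies strictly above log 54 / log 5, one sufficiently
  large \<open>K\<close> gives enough room for all losses: the factorial, the count 4^K / 2 and the
  rounding of \<rho> to an integer. The modulus m = 6 minimises log (m^3 / 4) / log (m - 1) over the
  integers. A second obstacle is that the two quantities are defined by \<open>GREATEST\<close> and
  \<open>LEAST\<close>, which say nothing until the extremum is known to exist. The capacity is
  therefore identified with a limit superior, and the exponent with an infimum that is shown to be
  admissible itself.\<close>

inductive derivable :: "'a::comm_ring_1 set \<Rightarrow> nat \<Rightarrow> 'a set \<Rightarrow> bool" where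
  available: "H \<subseteq> G \<Longrightarrow> derivable G m H"
| plus: "x \<in> G \<Longrightarrow> y \<in> G \<Longrightarrow> derivable (insert (x + y) G) m H \<Longrightarrow> derivable G (Suc m) H"
| times: "x \<in> G \<Longrightarrow> y \<in> G \<Longrightarrow> derivable (insert (x * y) G) m H \<Longrightarrow> derivable G (Suc m) H"

lemma derivable_mono:
  assumes "derivable G m H" "G \<subseteq> G'" "m \<le> m'" "H' \<subseteq> H"
  shows "derivable G' m' H'"
  using assms
proof (induction arbitrary: G' m' rule: derivable.induct)
  case (available H G m)
  then show ?case by (intro derivable.available) auto
next
  case (plus x G y m H)
  then obtain n where n: "m' = Suc n" "m \<le> n" by (auto simp: Suc_le_eq dest: less_imp_Suc_add)
  have "derivable (insert (x + y) G') n H'" using plus.prems n by (intro plus.IH) auto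
  then show ?case unfolding n(1) using plus.hyps plus.prems by (intro derivable.plus[of x G' y]) auto
next
  case (times x G y m H)
  then obtain n where n: "m' = Suc n" "m \<le> n" by (auto simp: Suc_le_eq dest: less_imp_Suc_add)
  have "derivable (insert (x * y) G') n H'" using times.prems n by (intro times.IH) auto
  then show ?case unfolding n(1) using times.hyps times.prems by (intro derivable.times[of x G' y]) auto
qed

lemma derivable_Un_available:
  assumes "derivable G m H" "K \<subseteq> G"
  shows "derivable G m (K \<union> H)"
  using assms
proof (induction rule: derivable.induct)
  case (available H G m)
  then show ?case by (intro derivable.available) simp
next
  case (plus x G y m H)
  show ?case
    by (rule derivable.plus[OF plus.hyps(1,2)], rule plus.IH) (use plus.prems in blast)
next
  case (times x G y m H)
  show ?case
    by (rule derivable.times[OF times.hyps(1,2)], rule times.IH) (use times.prems in blast)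
qed

text \<open>Keeping \<open>H\<close> in the conclusion lets a later stage use the results of all
  earlier stages, while the costs simply add up.\<close>

lemma derivable_trans:
  assumes "derivable G m H" "derivable (G \<union> H) m' H'"
  shows "derivable G (m + m') (H \<union> H')"
  using assms
proof (induction rule: derivable.induct)
  case (available H G m)
  then have "derivable G m' H'" by (simp add: Un_absorb2)
  from derivable_Un_available[OF this available(1)]
  show ?case by (rule derivable_mono) auto
next
  case (plus x G y m H)
  have "derivable (insert (x + y) G \<union> H) m' H'"
    using plus.prems by (rule derivable_mono) auto
  from derivable.plus[OF plus.hyps(1,2) plus.IH[OF this]] show ?case by simp
next
  case (times x G y m H)
  have "derivable (insert (x * y) G \<union> H) m' H'"
    using times.prems by (rule derivable_mono) auto
  from derivable.times[OF times.hyps(1,2) times.IH[OF this]] show ?case by simp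
qed

lemma derivable_UN:
  assumes "finite I" "\<And>i. i \<in> I \<Longrightarrow> derivable G m (F i)"
  shows "derivable G (card I * m) (\<Union>i\<in>I. F i)"
  using assms
proof (induction I rule: finite_induct)
  case empty
  then show ?case by (auto intro: derivable.available)
next
  case (insert i I)
  have "derivable (G \<union> F i) (card I * m) (\<Union>i\<in>I. F i)"
    by (rule derivable_mono[OF insert.IH]) (use insert.prems in auto)
  with insert.prems[of i] have "derivable G (m + card I * m) (F i \<union> (\<Union>i\<in>I. F i))"
    by (simp add: derivable_trans)
  then show ?case using insert by simp
qed

text \<open>The sum is built up from \<open>0\<close>, which therefore has to be available; each
  term then costs one product and one addition.\<close>

lemma derivable_lincomb:
  assumes "finite S" "0 \<in> G" "c ` S \<subseteq> G" "f ` S \<subseteq> G"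
  shows "derivable G (2 * card S) {\<Sum>s\<in>S. c s * f s}"
  using assms
proof (induction S rule: finite_induct)
  case empty
  then show ?case by (auto intro: derivable.available)
next
  case (insert s S)
  let ?T = "\<Sum>s\<in>S. c s * f s"
  have "derivable (G \<union> {?T}) 2 {c s * f s + ?T}"
    unfolding numeral_2_eq_2
  proof (rule derivable.times)
    show "derivable (insert (c s * f s) (G \<union> {?T})) (Suc 0) {c s * f s + ?T}"
      by (rule derivable.plus[of "c s * f s" _ ?T]) (simp_all add: derivable.available)
  qed (use insert.prems in simp_all)
  moreover have "derivable G (2 * card S) {?T}" using insert by auto
  ultimately have "derivable G (2 * card S + 2) ({?T} \<union> {c s * f s + ?T})"
    by (rule derivable_trans[rotated])
  then show ?case by (rule derivable_mono) (use insert.hyps in auto)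
qed

lemma derivable_lincombs:
  assumes "finite I" "finite S" "0 \<in> G" "\<And>p s. p \<in> I \<Longrightarrow> s \<in> S \<Longrightarrow> c p s \<in> G \<and> f p s \<in> G"
  shows "derivable G (card I * (2 * card S)) ((\<lambda>p. \<Sum>s\<in>S. c p s * f p s) ` I)"
proof -
  have "derivable G (card I * (2 * card S)) (\<Union>p\<in>I. {\<Sum>s\<in>S. c p s * f p s})"
    by (rule derivable_UN) (use assms in \<open>auto intro!: derivable_lincomb\<close>)
  then show ?thesis by (simp add: UNION_singleton_eq_range)
qed

section \<open>From derivations to programs\<close>

text \<open>The ring consists of the functions of the pair \<open>(A, B)\<close> with pointwise
  operations. An identity there is an identity for all inputs at once, so one derivation describes
  one program valid for every pair of matrices.\<close>

definition inputs :: "nat \<Rightarrow> (complex mat \<times> complex mat \<Rightarrow> complex) set" where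
  "inputs n = range (\<lambda>c _. c) \<union> {(\<lambda>(A, B). A $$ (i, j)) | i j. i < n \<and> j < n}
     \<union> {(\<lambda>(A, B). B $$ (i, j)) | i j. i < n \<and> j < n}"

definition holds_value ::
    "nat \<Rightarrow> (complex mat \<times> complex mat \<Rightarrow> complex) list \<Rightarrow> operand \<Rightarrow>
     (complex mat \<times> complex mat \<Rightarrow> complex) \<Rightarrow> bool" where
  "holds_value n fs p f \<longleftrightarrow> (\<forall>A\<in>carrier_mat n n. \<forall>B\<in>carrier_mat n n.
     operand_value A B (map (\<lambda>g. g (A, B)) fs) p = Some (f (A, B)))"

lemma operand_value_append:
  "operand_value A B vs p = Some x \<Longrightarrow> operand_value A B (vs @ ws) p = Some x"
  by (cases p) (auto simp: nth_append split: if_splits)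

lemma run_snoc_operation:
  assumes "holds_value n fs p f" "holds_value n fs q g"
    and "\<And>x y. apply_op a x y = Some (b x y)"
    and "A \<in> carrier_mat n n" "B \<in> carrier_mat n n"
  shows "run A B ((a, p, q) # prog) (map (\<lambda>g. g (A, B)) fs) =
     run A B prog (map (\<lambda>g. g (A, B)) (fs @ [\<lambda>x. b (f x) (g x)]))"
  using assms by (simp add: holds_value_def)

lemma holds_value_append: "holds_value n fs p f \<Longrightarrow> holds_value n (fs @ gs) p f"
  by (auto simp: holds_value_def operand_value_append)

lemma holds_value_last: "holds_value n (fs @ [f]) (Result (length fs)) f"
  by (auto simp: holds_value_def nth_append)

text \<open>Each derivation step becomes one instruction. Results are only ever appended, so
  operands found earlier stay valid; generalising over \<open>fs\<close> lets the induction build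
  the program from its front, in the order in which \<open>run\<close> executes it.\<close>

lemma derivable_imp_program:
  assumes "derivable G m H" "\<forall>g\<in>G. \<exists>p. holds_value n fs p g"
  shows "\<exists>prog fs'. length prog \<le> m \<and> (\<forall>h\<in>H. \<exists>p. holds_value n fs' p h) \<and>
    (\<forall>A\<in>carrier_mat n n. \<forall>B\<in>carrier_mat n n.
       run A B prog (map (\<lambda>g. g (A, B)) fs) = Some (map (\<lambda>g. g (A, B)) fs'))"
  using assms
proof (induction arbitrary: fs rule: derivable.induct)
  case (available H G m)
  then show ?case by (intro exI[of _ "[]"] exI[of _ fs]) auto
next
  case (plus x G y m H)
  let ?fs = "fs @ [x + y]"
  obtain p q where pq: "holds_value n fs p x" "holds_value n fs q y" using plus by blast
  have "\<forall>g\<in>insert (x + y) G. \<exists>p. holds_value n ?fs p g"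
    using plus.prems holds_value_append holds_value_last by blast
  then obtain prog fs' where *: "length prog \<le> m" "\<forall>h\<in>H. \<exists>p. holds_value n fs' p h"
    "\<forall>A\<in>carrier_mat n n. \<forall>B\<in>carrier_mat n n.
       run A B prog (map (\<lambda>g. g (A, B)) ?fs) = Some (map (\<lambda>g. g (A, B)) fs')"
    using plus.IH by metis
  have "run A B ((Plus, p, q) # prog) (map (\<lambda>g. g (A, B)) fs) = Some (map (\<lambda>g. g (A, B)) fs')"
    if "A \<in> carrier_mat n n" "B \<in> carrier_mat n n" for A B
    using run_snoc_operation[OF pq _ that, of Plus "(+)" prog] *(3) that by (simp add: plus_fun_def)
  then show ?case
    using *(1,2) by (intro exI[of _ "(Plus, p, q) # prog"] exI[of _ fs']) (simp del: run.simps)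
next
  case (times x G y m H)
  let ?fs = "fs @ [x * y]"
  obtain p q where pq: "holds_value n fs p x" "holds_value n fs q y" using times by blast
  have "\<forall>g\<in>insert (x * y) G. \<exists>p. holds_value n ?fs p g"
    using times.prems holds_value_append holds_value_last by blast
  then obtain prog fs' where *: "length prog \<le> m" "\<forall>h\<in>H. \<exists>p. holds_value n fs' p h"
    "\<forall>A\<in>carrier_mat n n. \<forall>B\<in>carrier_mat n n.
       run A B prog (map (\<lambda>g. g (A, B)) ?fs) = Some (map (\<lambda>g. g (A, B)) fs')"
    using times.IH by metis
  have "run A B ((Times, p, q) # prog) (map (\<lambda>g. g (A, B)) fs) = Some (map (\<lambda>g. g (A, B)) fs')"
    if "A \<in> carrier_mat n n" "B \<in> carrier_mat n n" for A B
    using run_snoc_operation[OF pq _ that, of Times "(*)" prog] *(3) that by (simp add: times_fun_def)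
  then show ?case
    using *(1,2) by (intro exI[of _ "(Times, p, q) # prog"] exI[of _ fs']) (simp del: run.simps)
qed

lemma sum_fun_apply: "(\<Sum>s\<in>S. f s) x = (\<Sum>s\<in>S. f s x)"
  by (induction S rule: infinite_finite_induct) auto

lemma matrix_mult_in_ops_if_derivable:
  assumes "derivable (inputs n) m
    {\<Sum>k<n. (\<lambda>(A, B). A $$ (i, k)) * (\<lambda>(A, B). B $$ (k, j)) | i j. i < n \<and> j < n}"
  shows "\<exists>m'\<le>m. matrix_mult_in_ops n m'"
proof -
  have "\<exists>p. holds_value n [] p g" if g: "g \<in> inputs n" for g
  proof -
    consider c where "g = (\<lambda>_. c)" | i j where "g = (\<lambda>(A, B). A $$ (i, j))" "i < n" "j < n"
      | i j where "g = (\<lambda>(A, B). B $$ (i, j))" "i < n" "j < n"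
      using g unfolding inputs_def by blast
    then show ?thesis
    proof cases
      case 1 then show ?thesis by (intro exI[of _ "Const c"]) (auto simp: holds_value_def)
    next
      case 2 then show ?thesis by (intro exI[of _ "Left_Entry i j"]) (auto simp: holds_value_def)
    next
      case 3 then show ?thesis by (intro exI[of _ "Right_Entry i j"]) (auto simp: holds_value_def)
    qed
  qed
  then obtain prog fs where prog: "length prog \<le> m"
    and fs: "\<forall>h\<in>{\<Sum>k<n. (\<lambda>(A, B). A $$ (i, k)) * (\<lambda>(A, B). B $$ (k, j)) | i j. i < n \<and> j < n}.
      \<exists>p. holds_value n fs p h"
    and run: "\<And>A B. A \<in> carrier_mat n n \<Longrightarrow> B \<in> carrier_mat n n \<Longrightarrow>
       run A B prog [] = Some (map (\<lambda>g. g (A, B)) fs)"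
    using derivable_imp_program[OF assms, of n "[]"] by auto
  define C :: "nat \<Rightarrow> nat \<Rightarrow> complex mat \<times> complex mat \<Rightarrow> complex" where
    "C i j = (\<Sum>k<n. (\<lambda>(A, B). A $$ (i, k)) * (\<lambda>(A, B). B $$ (k, j)))"
    for i j
  define out where "out i j = (SOME p. holds_value n fs p (C i j))" for i j
  have out: "holds_value n fs (out i j) (C i j)" if "i < n" "j < n" for i j
    unfolding out_def by (rule someI_ex) (use fs that in \<open>auto simp: C_def\<close>)
  have "operand_value A B (map (\<lambda>g. g (A, B)) fs) (out i j) = Some ((A * B) $$ (i, j))"
    if "A \<in> carrier_mat n n" "B \<in> carrier_mat n n" "i < n" "j < n" for A B i j
  proof -
    have "(A * B) $$ (i, j) = (\<Sum>k<n. A $$ (i, k) * B $$ (k, j))"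
      using that by (auto simp: scalar_prod_def lessThan_atLeast0 intro!: sum.cong)
    then show ?thesis
      using out[of i j] that by (simp add: holds_value_def C_def sum_fun_apply)
  qed
  with run have "computes_matrix_product n prog out"
    unfolding computes_matrix_product_def by simp
  then show ?thesis
    using prog unfolding matrix_mult_in_ops_def by blast
qed

section \<open>Recursive matrix multiplication\<close>

text \<open>A decomposition of rank \<open>R\<close> of the direct sum of \<open>r\<close> copies of
  the \<open>N\<close> by \<open>N\<close> matrix multiplication tensor, stated coefficient by
  coefficient. Mismatched indices have to give 0, so there are no cross terms between different
  products.\<close>

definition bilinear_algorithm ::
    "nat \<Rightarrow> nat \<Rightarrow> nat \<Rightarrow> (nat \<Rightarrow> nat \<times> nat \<times> nat \<Rightarrow> 'a::comm_ring_1) \<Rightarrow>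
     (nat \<Rightarrow> nat \<times> nat \<times> nat \<Rightarrow> 'a) \<Rightarrow> (nat \<Rightarrow> nat \<times> nat \<times> nat \<Rightarrow> 'a) \<Rightarrow> bool" where
  "bilinear_algorithm r N R \<alpha> \<beta> \<gamma> \<longleftrightarrow>
     (\<forall>t<r. \<forall>t'<r. \<forall>t''<r. \<forall>i<N. \<forall>i'<N. \<forall>j<N. \<forall>j'<N. \<forall>k<N. \<forall>k'<N.
        (\<Sum>l<R. \<alpha> l (t, i, k) * \<beta> l (t', k', j) * \<gamma> l (t'', i', j')) =
        of_bool (t = t' \<and> t' = t'' \<and> i = i' \<and> j = j' \<and> k = k'))"

text \<open>After expanding the product of the two linear forms, the coefficient identity leaves
  only the index pairs \<open>((t, a, c), (t, c, b))\<close>, one for each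
  \<open>c < N\<close>.\<close>

lemma bilinear_algorithm_entry:
  assumes alg: "bilinear_algorithm r N R \<alpha> \<beta> \<gamma>" and tab: "t < r" "a < N" "b < N"
  defines "S \<equiv> {..<r} \<times> {..<N} \<times> {..<N}"
  shows "(\<Sum>l<R. \<gamma> l (t, a, b) * ((\<Sum>p\<in>S. \<alpha> l p * x p) * (\<Sum>q\<in>S. \<beta> l q * y q))) =
    (\<Sum>c<N. x (t, a, c) * y (t, c, b))"
proof -
  let ?P = "\<lambda>z. fst (fst z) = fst (snd z) \<and> fst (snd z) = t \<and> fst (snd (fst z)) = a \<and>
    snd (snd (snd z)) = b \<and> snd (snd (fst z)) = fst (snd (snd z))"
  have coeff: "(\<Sum>l<R. \<alpha> l p * \<beta> l q * \<gamma> l (t, a, b)) = of_bool (?P (p, q))"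
    if pq: "p \<in> S" "q \<in> S" for p q
  proof -
    obtain t1 i k t2 k' j where eq: "p = (t1, i, k)" "q = (t2, k', j)" by (metis prod_cases3)
    show ?thesis
      using alg[unfolded bilinear_algorithm_def, rule_format, of t1 t2 t i a j b k k'] pq tab
      unfolding eq S_def by simp
  qed
  have fin: "finite S" by (simp add: S_def)
  have "(\<Sum>l<R. \<gamma> l (t, a, b) * ((\<Sum>p\<in>S. \<alpha> l p * x p) * (\<Sum>q\<in>S. \<beta> l q * y q))) =
      (\<Sum>l<R. \<Sum>z\<in>S \<times> S. (\<alpha> l (fst z) * \<beta> l (snd z) * \<gamma> l (t, a, b)) * (x (fst z) * y (snd z)))"
  proof (rule sum.cong[OF refl])
    fix l
    have "(\<Sum>p\<in>S. \<alpha> l p * x p) * (\<Sum>q\<in>S. \<beta> l q * y q) =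
        (\<Sum>z\<in>S \<times> S. (\<alpha> l (fst z) * x (fst z)) * (\<beta> l (snd z) * y (snd z)))"
      unfolding sum_product sum.cartesian_product by (simp add: split_def)
    then show "\<gamma> l (t, a, b) * ((\<Sum>p\<in>S. \<alpha> l p * x p) * (\<Sum>q\<in>S. \<beta> l q * y q)) =
        (\<Sum>z\<in>S \<times> S. (\<alpha> l (fst z) * \<beta> l (snd z) * \<gamma> l (t, a, b)) * (x (fst z) * y (snd z)))"
      by (simp add: sum_distrib_left mult_ac)
  qed
  also have "\<dots> = (\<Sum>z\<in>S \<times> S. (\<Sum>l<R. \<alpha> l (fst z) * \<beta> l (snd z) * \<gamma> l (t, a, b)) *
      (x (fst z) * y (snd z)))"
    by (subst sum.swap) (simp add: sum_distrib_right)
  also have "\<dots> = (\<Sum>z\<in>S \<times> S. if ?P z then x (fst z) * y (snd z) else 0)"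
    by (rule sum.cong[OF refl]) (auto simp: coeff)
  also have "\<dots> = (\<Sum>z | z \<in> S \<times> S \<and> ?P z. x (fst z) * y (snd z))"
    by (rule sum.inter_filter[symmetric]) (use fin in simp)
  also have "{z. z \<in> S \<times> S \<and> ?P z} = (\<lambda>c. ((t, a, c), (t, c, b))) ` {..<N}"
    using tab by (force simp: S_def)
  also have "(\<Sum>z\<in>(\<lambda>c. ((t, a, c), (t, c, b))) ` {..<N}. x (fst z) * y (snd z)) =
      (\<Sum>c<N. x (t, a, c) * y (t, c, b))"
    by (subst sum.reindex) (auto simp: inj_on_def)
  finally show ?thesis .
qed

lemma sum_blocks: "(\<Sum>c<N. \<Sum>k<M. f (c * M + k)) = (\<Sum>k<N * M. f k)" for N M :: nat
proof -
  have "(\<Sum>k<M. f (c * M + k)) = sum f {c * M..<c * M + M}" for c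
    using sum.shift_bounds_nat_ivl[of f 0 "c * M" M] by (simp add: lessThan_atLeast0 add.commute)
  then show ?thesis by (simp add: sum.nat_group)
qed

text \<open>Blocks do not commute, whereas the coefficient identity lives in a commutative ring. For
  fixed positions \<open>i\<close>, \<open>k\<close>, \<open>j\<close> inside the blocks the entries
  are ring elements, so the scalar case applies; summing over \<open>k\<close> then assembles the
  block products.\<close>

lemma bilinear_algorithm_blocks:
  assumes alg: "bilinear_algorithm r N R \<alpha> \<beta> \<gamma>" and tab: "t < r" "a < N" "b < N"
  defines "S \<equiv> {..<r} \<times> {..<N} \<times> {..<N}"
  shows "(\<Sum>l<R. \<gamma> l (t, a, b) *
      (\<Sum>k<M. (\<Sum>(u, c, d)\<in>S. \<alpha> l (u, c, d) * X u (c * M + i) (d * M + k)) *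
             (\<Sum>(u, c, d)\<in>S. \<beta> l (u, c, d) * Y u (c * M + k) (d * M + j)))) =
    (\<Sum>k<N * M. X t (a * M + i) k * Y t k (b * M + j))"
proof -
  have "(\<Sum>l<R. \<gamma> l (t, a, b) *
      (\<Sum>k<M. (\<Sum>(u, c, d)\<in>S. \<alpha> l (u, c, d) * X u (c * M + i) (d * M + k)) *
             (\<Sum>(u, c, d)\<in>S. \<beta> l (u, c, d) * Y u (c * M + k) (d * M + j)))) =
    (\<Sum>k<M. \<Sum>l<R. \<gamma> l (t, a, b) *
      ((\<Sum>(u, c, d)\<in>S. \<alpha> l (u, c, d) * X u (c * M + i) (d * M + k)) *
             (\<Sum>(u, c, d)\<in>S. \<beta> l (u, c, d) * Y u (c * M + k) (d * M + j))))"
    unfolding sum_distrib_left by (rule sum.swap)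
  also have "\<dots> = (\<Sum>k<M. \<Sum>c<N. X t (a * M + i) (c * M + k) * Y t (c * M + k) (b * M + j))"
  proof (rule sum.cong[OF refl])
    fix k
    show "(\<Sum>l<R. \<gamma> l (t, a, b) *
      ((\<Sum>(u, c, d)\<in>S. \<alpha> l (u, c, d) * X u (c * M + i) (d * M + k)) *
             (\<Sum>(u, c, d)\<in>S. \<beta> l (u, c, d) * Y u (c * M + k) (d * M + j)))) =
      (\<Sum>c<N. X t (a * M + i) (c * M + k) * Y t (c * M + k) (b * M + j))"
      using bilinear_algorithm_entry[OF alg tab, of "\<lambda>(u, c, d). X u (c * M + i) (d * M + k)"
          "\<lambda>(u, c, d). Y u (c * M + k) (d * M + j)"]
      by (simp add: S_def split_def)
  qed
  also have "\<dots> = (\<Sum>c<N. \<Sum>k<M. X t (a * M + i) (c * M + k) * Y t (c * M + k) (b * M + j))"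
    by (rule sum.swap)
  also have "\<dots> = (\<Sum>k<N * M. X t (a * M + i) k * Y t k (b * M + j))"
    by (rule sum_blocks)
  finally show ?thesis .
qed

text \<open>Quantifying over \<open>G\<close>, \<open>X\<close> and \<open>Y\<close> allows the
  recursion to feed in linear combinations computed on the way as new matrices.\<close>

definition products_derivable :: "'a::comm_ring_1 set \<Rightarrow> nat \<Rightarrow> nat \<Rightarrow> nat \<Rightarrow> bool" where
  "products_derivable K r N T \<longleftrightarrow> (\<forall>G X Y. K \<subseteq> G \<longrightarrow>
     (\<forall>t<r. \<forall>i<N. \<forall>j<N. X t i j \<in> G \<and> Y t i j \<in> G) \<longrightarrow>
     derivable G T ((\<lambda>(t, i, j). \<Sum>k<N. X t i k * Y t k j) ` ({..<r} \<times> {..<N} \<times> {..<N})))"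

lemma products_derivableD:
  assumes "products_derivable K r N T" "K \<subseteq> G"
    and "\<And>t i j. t < r \<Longrightarrow> i < N \<Longrightarrow> j < N \<Longrightarrow> X t i j \<in> G \<and> Y t i j \<in> G"
  shows "derivable G T ((\<lambda>(t, i, j). \<Sum>k<N. X t i k * Y t k j) ` ({..<r} \<times> {..<N} \<times> {..<N}))"
  using assms unfolding products_derivable_def by simp

lemma products_derivable_1: "products_derivable K r 1 r"
  unfolding products_derivable_def
proof (intro allI impI)
  fix G and X Y :: "nat \<Rightarrow> nat \<Rightarrow> nat \<Rightarrow> 'a"
  assume XY: "\<forall>t<r. \<forall>i<1. \<forall>j<1. X t i j \<in> G \<and> Y t i j \<in> G"
  have "derivable G (card {..<r} * Suc 0) (\<Union>t\<in>{..<r}. {X t 0 0 * Y t 0 0})"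
  proof (rule derivable_UN)
    fix t assume "t \<in> {..<r}"
    then show "derivable G (Suc 0) {X t 0 0 * Y t 0 0}"
      using XY by (intro derivable.times[of "X t 0 0" G "Y t 0 0"] derivable.available) auto
  qed simp
  moreover have "(\<lambda>(t, i, j). \<Sum>k<1. X t i k * Y t k j) ` ({..<r} \<times> {..<1} \<times> {..<1}) =
    (\<Union>t\<in>{..<r}. {X t 0 0 * Y t 0 0})"
    by (auto simp: lessThan_Suc image_iff)
  ultimately show "derivable G r
      ((\<lambda>(t, i, j). \<Sum>k<1. X t i k * Y t k j) ` ({..<r} \<times> {..<1} \<times> {..<1}))"
    by simp
qed

text \<open>The \<open>R\<close> block products are computed in \<open>\<rho>\<close> batches of \<open>r\<close> independent ones, so that the
  hypothesis on independent products of smaller matrices is used again without any loss.\<close>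

lemma products_derivable_mult:
  assumes alg: "bilinear_algorithm r N R \<alpha> \<beta> \<gamma>"
    and K: "0 \<in> K" "\<And>l p. \<alpha> l p \<in> K \<and> \<beta> l p \<in> K \<and> \<gamma> l p \<in> K"
    and R: "R \<le> \<rho> * r" and M: "products_derivable K r M T"
  shows "products_derivable K r (N * M) (\<rho> * T + 6 * R * r * N\<^sup>2 * M\<^sup>2)"
  unfolding products_derivable_def
proof (intro allI impI)
  fix G and X Y :: "nat \<Rightarrow> nat \<Rightarrow> nat \<Rightarrow> 'a"
  assume G: "K \<subseteq> G" and XY: "\<forall>t<r. \<forall>i<N*M. \<forall>j<N*M. X t i j \<in> G \<and> Y t i j \<in> G"
  define S where "S = {..<r} \<times> {..<N} \<times> {..<N}"
  define I where "I = {..<R} \<times> {..<M} \<times> {..<M}"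
  define L where "L l i k = (\<Sum>(u, c, d)\<in>S. \<alpha> l (u, c, d) * X u (c * M + i) (d * M + k))" for l i k
  define L' where "L' l k j = (\<Sum>(u, c, d)\<in>S. \<beta> l (u, c, d) * Y u (c * M + k) (d * M + j))" for l k j
  define P where "P l i j = (\<Sum>k<M. L l i k * L' l k j)" for l i j
  define HL where "HL = (\<lambda>(l, i, j). L l i j) ` I"
  define HL' where "HL' = (\<lambda>(l, i, j). L' l i j) ` I"
  define HP where "HP = (\<lambda>(l, i, j). P l i j) ` I"
  have mem: "L l i j \<in> HL" "L' l i j \<in> HL'" "P l i j \<in> HP" if "l < R" "i < M" "j < M" for l i j
    unfolding HL_def HL'_def HP_def using that
    by (auto simp: I_def intro!: image_eqI[of _ _ "(l, i, j)"])
  have KG: "0 \<in> G" "\<alpha> l p \<in> G" "\<beta> l p \<in> G" "\<gamma> l p \<in> G" for l p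
    using G K by blast+
  have fin: "finite S" "finite I" by (auto simp: S_def I_def)
  have bound: "a * M + i < N * M" if "a < N" "i < M" for a i
  proof -
    have "a * M + i < Suc a * M" using that by simp
    also have "\<dots> \<le> N * M" using that by (intro mult_le_mono1) simp
    finally show ?thesis .
  qed
  have "derivable G (card I * (2 * card S))
      ((\<lambda>p. \<Sum>s\<in>S. (\<lambda>(l, i, k). \<alpha> l s) p * (\<lambda>(l, i, k). (\<lambda>(u, c, d). X u (c * M + i) (d * M + k)) s) p) ` I)"
    by (rule derivable_lincombs) (use fin KG XY in \<open>auto simp: S_def I_def bound\<close>)
  also have "(\<lambda>p. \<Sum>s\<in>S. (\<lambda>(l, i, k). \<alpha> l s) p * (\<lambda>(l, i, k). (\<lambda>(u, c, d). X u (c * M + i) (d * M + k)) s) p) ` I = HL"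
    by (auto simp: HL_def L_def split_def)
  finally have dL: "derivable G (card I * (2 * card S)) HL" .
  have "derivable G (card I * (2 * card S))
      ((\<lambda>p. \<Sum>s\<in>S. (\<lambda>(l, i, k). \<beta> l s) p * (\<lambda>(l, i, k). (\<lambda>(u, c, d). Y u (c * M + i) (d * M + k)) s) p) ` I)"
    by (rule derivable_lincombs) (use fin KG XY in \<open>auto simp: S_def I_def bound\<close>)
  also have "(\<lambda>p. \<Sum>s\<in>S. (\<lambda>(l, i, k). \<beta> l s) p * (\<lambda>(l, i, k). (\<lambda>(u, c, d). Y u (c * M + i) (d * M + k)) s) p) ` I = HL'"
    by (auto simp: HL'_def L'_def split_def)
  finally have "derivable G (card I * (2 * card S)) HL'" .
  then have "derivable (G \<union> HL) (card I * (2 * card S)) HL'"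
    by (rule derivable_mono) auto
  from derivable_trans[OF dL this]
  have d1: "derivable G (card I * (2 * card S) + card I * (2 * card S)) (HL \<union> HL')" .
  let ?G = "G \<union> (HL \<union> HL')"
  \<comment> \<open>The last batches may run past the \<open>R\<close> products that are wanted;
    they are filled up with zero matrices.\<close>
  define Z where "Z F l i j = (if l < R then F l i j else 0)" for F :: "nat \<Rightarrow> nat \<Rightarrow> nat \<Rightarrow> 'a" and l i j
  have dB: "derivable ?G (card {..<\<rho>} * T) (\<Union>b\<in>{..<\<rho>}.
    ((\<lambda>(t, i, j). \<Sum>k<M. Z L (b * r + t) i k * Z L' (b * r + t) k j) ` ({..<r} \<times> {..<M} \<times> {..<M})))"
  proof (rule derivable_UN)
    fix b
    show "derivable ?G T
      ((\<lambda>(t, i, j). \<Sum>k<M. Z L (b * r + t) i k * Z L' (b * r + t) k j) ` ({..<r} \<times> {..<M} \<times> {..<M}))"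
      by (rule products_derivableD[OF M]) (use G KG mem in \<open>auto simp: Z_def\<close>)
  qed simp
  have sub: "HP \<subseteq> (\<Union>b\<in>{..<\<rho>}.
    ((\<lambda>(t, i, j). \<Sum>k<M. Z L (b * r + t) i k * Z L' (b * r + t) k j) ` ({..<r} \<times> {..<M} \<times> {..<M})))"
  proof
    fix h assume "h \<in> HP"
    then obtain l i j where l: "l < R" "i < M" "j < M" "h = P l i j" by (auto simp: HP_def I_def)
    have "l < \<rho> * r" using l(1) R by simp
    \<comment> \<open>Product \<open>l\<close> is number \<open>l mod r\<close> of batch
      \<open>l div r\<close>.\<close>
    then have "l div r < \<rho>" "0 < r" by (auto simp: less_mult_imp_div_less intro: gr0I)
    moreover have "h = (\<lambda>(t, i, j). \<Sum>k<M. Z L (l div r * r + t) i k * Z L' (l div r * r + t) k j) (l mod r, i, j)"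
      using l by (simp add: Z_def P_def)
    ultimately show "h \<in> (\<Union>b\<in>{..<\<rho>}.
    ((\<lambda>(t, i, j). \<Sum>k<M. Z L (b * r + t) i k * Z L' (b * r + t) k j) ` ({..<r} \<times> {..<M} \<times> {..<M})))"
      using l by (intro UN_I[of "l div r"] image_eqI[of _ _ "(l mod r, i, j)"]) auto
  qed
  have "derivable ?G (\<rho> * T) HP"
    by (rule derivable_mono[OF dB order_refl _ sub]) simp
  from derivable_trans[OF d1 this]
  have d2: "derivable G (card I * (2 * card S) + card I * (2 * card S) + \<rho> * T) (HL \<union> HL' \<union> HP)" .
  define J where "J = {..<r} \<times> {..<N * M} \<times> {..<N * M}"
  have M0: "0 < M" if "i < N * M" for i using that by (auto intro: gr0I)
  have "derivable (G \<union> (HL \<union> HL' \<union> HP)) (card J * (2 * card {..<R}))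
     ((\<lambda>p. \<Sum>l<R. (\<lambda>(t, i, j). \<gamma> l (t, i div M, j div M)) p * (\<lambda>(t, i, j). P l (i mod M) (j mod M)) p) ` J)"
    by (rule derivable_lincombs) (use KG M0 mem in \<open>auto simp: J_def\<close>)
  also have "(\<lambda>p. \<Sum>l<R. (\<lambda>(t, i, j). \<gamma> l (t, i div M, j div M)) p * (\<lambda>(t, i, j). P l (i mod M) (j mod M)) p) ` J =
      (\<lambda>(t, i, j). \<Sum>k<N * M. X t i k * Y t k j) ` J"
  proof (rule image_cong[OF refl])
    fix p assume "p \<in> J"
    then obtain t i j where p: "p = (t, i, j)" "t < r" "i < N * M" "j < N * M" by (auto simp: J_def)
    have "(\<Sum>l<R. \<gamma> l (t, i div M, j div M) * P l (i mod M) (j mod M)) =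
        (\<Sum>k<N * M. X t (i div M * M + i mod M) k * Y t k (j div M * M + j mod M))"
      unfolding P_def L_def L'_def S_def
      by (rule bilinear_algorithm_blocks[OF alg p(2)]) (use p in \<open>auto simp: less_mult_imp_div_less\<close>)
    then show "(\<Sum>l<R. (\<lambda>(t, i, j). \<gamma> l (t, i div M, j div M)) p * (\<lambda>(t, i, j). P l (i mod M) (j mod M)) p) =
      (\<lambda>(t, i, j). \<Sum>k<N * M. X t i k * Y t k j) p"
      by (simp add: p(1))
  qed
  finally have "derivable (G \<union> (HL \<union> HL' \<union> HP)) (card J * (2 * card {..<R}))
      ((\<lambda>(t, i, j). \<Sum>k<N * M. X t i k * Y t k j) ` J)" .
  from derivable_trans[OF d2 this]
  show "derivable G (\<rho> * T + 6 * R * r * N\<^sup>2 * M\<^sup>2)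
      ((\<lambda>(t, i, j). \<Sum>k<N * M. X t i k * Y t k j) ` ({..<r} \<times> {..<N * M} \<times> {..<N * M}))"
    unfolding J_def[symmetric]
  proof (rule derivable_mono)
    \<comment> \<open>The factor 6 comes from three linear stages, the two encodings and the
      decoding, each of cost \<open>2 * R * r * N^2 * M^2\<close>.\<close>
    have "card I = R * M\<^sup>2" "card S = r * N\<^sup>2" "card J = r * (N\<^sup>2 * M\<^sup>2)"
      by (simp_all add: I_def S_def J_def power2_eq_square)
    then show "card I * (2 * card S) + card I * (2 * card S) + \<rho> * T + card J * (2 * card {..<R})
      \<le> \<rho> * T + 6 * R * r * N\<^sup>2 * M\<^sup>2"
      by (simp add: algebra_simps)
  qed auto
qed

text \<open>The extra summand \<open>c * (N ^ s)^2\<close> makes the induction close: a step adds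
  overhead \<open>c * M^2\<close> for \<open>M = N ^ s\<close>, and together with the next summand
  \<open>c * N^2 * M^2\<close> this is at most \<open>\<rho> * c * M^2\<close>. Without it the bound
  would not reproduce itself.\<close>

lemma products_derivable_power:
  assumes alg: "bilinear_algorithm r N R \<alpha> \<beta> \<gamma>"
    and K: "0 \<in> K" "\<And>l p. \<alpha> l p \<in> K \<and> \<beta> l p \<in> K \<and> \<gamma> l p \<in> K"
    and R: "R \<le> \<rho> * r" and \<rho>: "N\<^sup>2 + 1 \<le> \<rho>"
  defines "c \<equiv> 6 * R * r * N\<^sup>2"
  shows "\<exists>T. products_derivable K r (N ^ s) T \<and> T + c * (N ^ s)\<^sup>2 \<le> (r + c) * \<rho> ^ s"
proof (induction s)
  case 0
  then show ?case using products_derivable_1[of K r] by (auto intro!: exI[of _ r])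
next
  case (Suc s)
  then obtain T where T: "products_derivable K r (N ^ s) T" "T + c * (N ^ s)\<^sup>2 \<le> (r + c) * \<rho> ^ s"
    by blast
  have "products_derivable K r (N * N ^ s) (\<rho> * T + c * (N ^ s)\<^sup>2)"
    using products_derivable_mult[OF alg K R T(1)] by (simp add: c_def)
  moreover have "\<rho> * T + c * (N ^ s)\<^sup>2 + c * (N * N ^ s)\<^sup>2 \<le> (r + c) * \<rho> ^ Suc s"
  proof -
    have "\<rho> * T + c * (N ^ s)\<^sup>2 + c * (N * N ^ s)\<^sup>2 = \<rho> * T + (N\<^sup>2 + 1) * (c * (N ^ s)\<^sup>2)"
      by (simp add: algebra_simps)
    also have "\<dots> \<le> \<rho> * T + \<rho> * (c * (N ^ s)\<^sup>2)"
      using \<rho> by (intro add_left_mono mult_right_mono) auto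
    also have "\<dots> = \<rho> * (T + c * (N ^ s)\<^sup>2)" by (simp add: algebra_simps)
    also have "\<dots> \<le> \<rho> * ((r + c) * \<rho> ^ s)" using T(2) by (intro mult_left_mono) auto
    finally show ?thesis by (simp add: algebra_simps)
  qed
  ultimately show ?case by (intro exI[of _ "\<rho> * T + c * (N ^ s)\<^sup>2"]) simp
qed

section \<open>Programs for a single matrix product\<close>

lemma bilinear_algorithm_fun:
  assumes "bilinear_algorithm r N R \<alpha> \<beta> \<gamma>"
  shows "bilinear_algorithm r N R (\<lambda>l p _. \<alpha> l p) (\<lambda>l p _. \<beta> l p) (\<lambda>l p _. \<gamma> l p)"
  unfolding bilinear_algorithm_def
proof (intro allI impI ext)
  fix t t' t'' i i' j j' k k' and x :: 'b
  assume "t < r" "t' < r" "t'' < r" "i < N" "i' < N" "j < N" "j' < N" "k < N" "k' < N"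
  then have "(\<Sum>l<R. \<alpha> l (t, i, k) * \<beta> l (t', k', j) * \<gamma> l (t'', i', j')) =
      of_bool (t = t' \<and> t' = t'' \<and> i = i' \<and> j = j' \<and> k = k')"
    using assms unfolding bilinear_algorithm_def by simp
  then show "(\<Sum>l<R. (\<lambda>_. \<alpha> l (t, i, k)) * (\<lambda>_. \<beta> l (t', k', j)) * (\<lambda>_. \<gamma> l (t'', i', j'))) x =
      of_bool (t = t' \<and> t' = t'' \<and> i = i' \<and> j = j' \<and> k = k') x"
    by (simp add: sum_fun_apply of_bool_def)
qed

text \<open>All \<open>r\<close> products are copies of the wanted one, padded with zeros to size
  \<open>N ^ s\<close>, and the result is read off from copy 0. This waste does not affect the
  growth in \<open>s\<close>.\<close>

lemma matrix_mult_in_ops_power: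
  fixes \<alpha> \<beta> \<gamma> :: "nat \<Rightarrow> nat \<times> nat \<times> nat \<Rightarrow> complex"
  assumes alg: "bilinear_algorithm r N R \<alpha> \<beta> \<gamma>" and r: "0 < r"
    and R: "R \<le> \<rho> * r" and \<rho>: "N\<^sup>2 + 1 \<le> \<rho>" and n: "n \<le> N ^ s"
  shows "\<exists>m \<le> (r + 6 * R * r * N\<^sup>2) * \<rho> ^ s. matrix_mult_in_ops n m"
proof -
  define X :: "nat \<Rightarrow> nat \<Rightarrow> nat \<Rightarrow> complex mat \<times> complex mat \<Rightarrow> complex"
    where "X t i j = (if i < n \<and> j < n then \<lambda>(A, B). A $$ (i, j) else 0)" for t i j
  define Y :: "nat \<Rightarrow> nat \<Rightarrow> nat \<Rightarrow> complex mat \<times> complex mat \<Rightarrow> complex"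
    where "Y t i j = (if i < n \<and> j < n then \<lambda>(A, B). B $$ (i, j) else 0)" for t i j
  let ?K = "range (\<lambda>c _. c) :: (complex mat \<times> complex mat \<Rightarrow> complex) set"
  let ?c = "6 * R * r * N\<^sup>2"
  have K: "0 \<in> ?K" by (auto simp: zero_fun_def)
  have coeffs: "(\<lambda>_. \<alpha> l p) \<in> ?K \<and> (\<lambda>_. \<beta> l p) \<in> ?K \<and> (\<lambda>_. \<gamma> l p) \<in> ?K" for l p by blast
  obtain T where T: "products_derivable ?K r (N ^ s) T" "T + ?c * (N ^ s)\<^sup>2 \<le> (r + ?c) * \<rho> ^ s"
    using products_derivable_power[OF bilinear_algorithm_fun[OF alg] K coeffs R \<rho>] by blast
  have sub: "?K \<subseteq> inputs n" by (auto simp: inputs_def)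
  have mem: "X t i j \<in> inputs n \<and> Y t i j \<in> inputs n" for t i j
  proof -
    have "0 \<in> inputs n" using K sub by blast
    then show ?thesis unfolding X_def Y_def by (simp, unfold inputs_def, blast)
  qed
  have d: "derivable (inputs n) T
     ((\<lambda>(t, i, j). \<Sum>k<N ^ s. X t i k * Y t k j) ` ({..<r} \<times> {..<N ^ s} \<times> {..<N ^ s}))"
    by (rule products_derivableD[OF T(1) sub]) (rule mem)
  have "derivable (inputs n) ((r + ?c) * \<rho> ^ s)
    {\<Sum>k<n. (\<lambda>(A, B). A $$ (i, k)) * (\<lambda>(A, B). B $$ (k, j)) | i j. i < n \<and> j < n}"
  proof (rule derivable_mono[OF d])
    show "T \<le> (r + ?c) * \<rho> ^ s" using T(2) by linarith
    show "{\<Sum>k<n. (\<lambda>(A, B). A $$ (i, k)) * (\<lambda>(A, B). B $$ (k, j)) | i j. i < n \<and> j < n} \<subseteq>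
      (\<lambda>(t, i, j). \<Sum>k<N ^ s. X t i k * Y t k j) ` ({..<r} \<times> {..<N ^ s} \<times> {..<N ^ s})"
    proof
      fix h :: "complex mat \<times> complex mat \<Rightarrow> complex"
      assume "h \<in> {\<Sum>k<n. (\<lambda>(A, B). A $$ (i, k)) * (\<lambda>(A, B). B $$ (k, j)) | i j. i < n \<and> j < n}"
      then obtain i j where ij: "i < n" "j < n"
        and h: "h = (\<Sum>k<n. (\<lambda>(A, B). A $$ (i, k)) * (\<lambda>(A, B). B $$ (k, j)))" by blast
      have "h = (\<Sum>k<N ^ s. X 0 i k * Y 0 k j)"
        unfolding h by (rule sum.mono_neutral_cong_left) (use n ij in \<open>simp_all add: X_def Y_def\<close>)
      then show "h \<in> (\<lambda>(t, i, j). \<Sum>k<N ^ s. X t i k * Y t k j) ` ({..<r} \<times> {..<N ^ s} \<times> {..<N ^ s})"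
        using r ij n by (intro image_eqI[of _ _ "(0, i, j)"]) simp_all
    qed
  qed (rule subset_refl)
  then show ?thesis by (rule matrix_mult_in_ops_if_derivable)
qed

section \<open>Bilinear algorithms from strong uniquely solvable puzzles\<close>

text \<open>Orthogonality of the characters of Z/m: unless \<open>m\<close> divides
  \<open>g\<close>, the sum is a geometric series in an \<open>m\<close>-th root of unity other than
  1.\<close>

lemma sum_cis_multiples:
  fixes g :: int
  assumes "0 < m"
  shows "(\<Sum>c<m. cis (2 * pi * real c * of_int g / real m)) = (if int m dvd g then of_nat m else 0)"
proof -
  define z where "z = cis (2 * pi * of_int g / real m)"
  have power: "cis (2 * pi * real c * of_int g / real m) = z ^ c" for c
    by (simp add: z_def DeMoivre mult_ac)
  show ?thesis
  proof (cases "int m dvd g")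
    case True
    then obtain h where "g = int m * h" by blast
    then have "2 * pi * of_int g / real m = 2 * pi * of_int h" using assms by simp
    then have "z = cis (2 * pi * of_int h)" unfolding z_def by (rule arg_cong)
    then have "z = 1" using cis_multiple_2pi[of "of_int h"] by simp
    then show ?thesis using True by (simp add: power)
  next
    case False
    have "z \<noteq> 1"
    proof
      assume "z = 1"
      then have "cos (2 * pi * of_int g / real m) = 1" by (simp add: z_def complex_eq_iff)
      then obtain h :: int where "2 * pi * of_int g / real m = of_int h * 2 * pi"
        using cos_one_2pi_int by blast
      then have "real_of_int g = real_of_int (int m * h)" using assms by (simp add: field_simps)
      then have "g = int m * h" by (simp only: of_int_eq_iff)
      then show False using False by simp
    qed
    moreover have "z ^ m = 1" using assms by (simp add: z_def DeMoivre)
    ultimately show ?thesis using False by (simp add: power geometric_sum)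
  qed
qed

lemma sum_characters:
  fixes g :: "'b \<Rightarrow> int"
  assumes "finite I" "0 < m"
  shows "(\<Sum>c\<in>I \<rightarrow>\<^sub>E {..<m}. \<Prod>x\<in>I. cis (2 * pi * real (c x) * of_int (g x) / real m)) =
    of_nat (m ^ card I) * of_bool (\<forall>x\<in>I. int m dvd g x)"
proof -
  have "(\<Sum>c\<in>I \<rightarrow>\<^sub>E {..<m}. \<Prod>x\<in>I. cis (2 * pi * real (c x) * of_int (g x) / real m)) =
      (\<Prod>x\<in>I. \<Sum>c<m. cis (2 * pi * real c * of_int (g x) / real m))"
    by (rule prod_sum_PiE[symmetric]) (use assms in auto)
  also have "\<dots> = (\<Prod>x\<in>I. if int m dvd g x then of_nat m else 0)"
    using assms by (simp add: sum_cis_multiples)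
  also have "\<dots> = of_nat (m ^ card I) * of_bool (\<forall>x\<in>I. int m dvd g x)"
    using assms(1) by (auto simp: prod_zero_iff intro!: prod_zero)
  finally show ?thesis .
qed

text \<open>The group algebra of \<open>(\<int>/m)\<^sup>I\<close> is diagonalised by its \<open>m ^ card I\<close> characters. Entries of
  the three matrices are placed at group elements whose sum vanishes exactly for matching indices.\<close>

lemma bilinear_algorithm_of_group_embedding:
  fixes gX gY gZ :: "nat \<times> nat \<times> nat \<Rightarrow> 'b \<Rightarrow> int"
  assumes I: "finite I" and m: "0 < m"
    and g: "\<And>t t' t'' i i' j j' k k'. t < r \<Longrightarrow> t' < r \<Longrightarrow> t'' < r \<Longrightarrow> i < N \<Longrightarrow> i' < N \<Longrightarrow>
      j < N \<Longrightarrow> j' < N \<Longrightarrow> k < N \<Longrightarrow> k' < N \<Longrightarrow>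
      (\<forall>x\<in>I. int m dvd gX (t, i, k) x + gY (t', k', j) x + gZ (t'', i', j') x) \<longleftrightarrow>
      t = t' \<and> t' = t'' \<and> i = i' \<and> j = j' \<and> k = k'"
  shows "\<exists>\<alpha> \<beta> \<gamma> :: nat \<Rightarrow> nat \<times> nat \<times> nat \<Rightarrow> complex. bilinear_algorithm r N (m ^ card I) \<alpha> \<beta> \<gamma>"
proof -
  let ?R = "m ^ card I"
  have "card (I \<rightarrow>\<^sub>E {..<m}) = ?R" using I by (simp add: card_PiE)
  then obtain c where c: "bij_betw c {..<?R} (I \<rightarrow>\<^sub>E {..<m})"
    using I ex_bij_betw_nat_finite[of "I \<rightarrow>\<^sub>E {..<m}"] by (auto simp: lessThan_atLeast0 finite_PiE)
  \<comment> \<open>\<open>\<psi> g l p\<close> is the value of character number \<open>l\<close> at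
    the group element \<open>g p\<close>. Characters are multiplicative, so a product of three
    values is the value at the sum of the elements, and summing over all characters tests whether
    that sum is 0. Dividing by the group order normalises the test.\<close>
  define \<psi> where "\<psi> g l p = (\<Prod>x\<in>I. cis (2 * pi * real (c l x) * of_int (g p x) / real m))"
    for g :: "nat \<times> nat \<times> nat \<Rightarrow> 'b \<Rightarrow> int" and l p
  have "bilinear_algorithm r N ?R (\<psi> gX) (\<psi> gY) (\<lambda>l p. \<psi> gZ l p / of_nat ?R)"
    unfolding bilinear_algorithm_def
  proof (intro allI impI)
    fix t t' t'' i i' j j' k k'
    assume *: "t < r" "t' < r" "t'' < r" "i < N" "i' < N" "j < N" "j' < N" "k < N" "k' < N"
    let ?g = "\<lambda>x. gX (t, i, k) x + gY (t', k', j) x + gZ (t'', i', j') x"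
    have "\<psi> gX l (t, i, k) * \<psi> gY l (t', k', j) * \<psi> gZ l (t'', i', j') =
        (\<Prod>x\<in>I. cis (2 * pi * real (c l x) * of_int (?g x) / real m))" for l
      by (simp add: \<psi>_def prod.distrib[symmetric] cis_mult add_divide_distrib distrib_left)
    then have "(\<Sum>l<?R. \<psi> gX l (t, i, k) * \<psi> gY l (t', k', j) * (\<psi> gZ l (t'', i', j') / of_nat ?R)) =
        (\<Sum>l<?R. \<Prod>x\<in>I. cis (2 * pi * real (c l x) * of_int (?g x) / real m)) / of_nat ?R"
      by (simp add: sum_divide_distrib)
    also have "(\<Sum>l<?R. \<Prod>x\<in>I. cis (2 * pi * real (c l x) * of_int (?g x) / real m)) =
        of_nat ?R * of_bool (\<forall>x\<in>I. int m dvd ?g x)"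
      unfolding sum.reindex_bij_betw[OF c,
          of "\<lambda>c. \<Prod>x\<in>I. cis (2 * pi * real (c x) * of_int (?g x) / real m)"]
      by (rule sum_characters[OF I m])
    also have "\<dots> / of_nat ?R = of_bool (\<forall>x\<in>I. int m dvd ?g x)"
      using m by simp
    also have "(\<forall>x\<in>I. int m dvd ?g x) \<longleftrightarrow> t = t' \<and> t' = t'' \<and> i = i' \<and> j = j' \<and> k = k'"
      using * by (rule g)
    finally show "(\<Sum>l<?R. \<psi> gX l (t, i, k) * \<psi> gY l (t', k', j) * (\<psi> gZ l (t'', i', j') / of_nat ?R)) =
        of_bool (t = t' \<and> t' = t'' \<and> i = i' \<and> j = j' \<and> k = k')" .
  qed
  then show ?thesis by blast
qed

text \<open>The entry of the first matrix vanishes exactly at the letters \<open>1\<close> of its word, and similarly for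
  the second matrix and \<open>2\<close>, and the third and \<open>3\<close>. If exactly two of three entries vanish
  at some position, then the sum of the three does not.\<close>

lemma bilinear_algorithm_of_words:
  fixes w :: "nat \<Rightarrow> 'b \<Rightarrow> nat"
  assumes I: "finite I" and m: "0 < m"
    and letters: "\<And>t x. t < r \<Longrightarrow> x \<in> I \<Longrightarrow> w t x \<in> {1, 2, 3}"
    and count: "\<And>t a. t < r \<Longrightarrow> a \<in> {1, 2, 3} \<Longrightarrow> card {x\<in>I. w t x = a} = D"
    and separated: "\<And>t t' t''. t < r \<Longrightarrow> t' < r \<Longrightarrow> t'' < r \<Longrightarrow> \<not> (t = t' \<and> t' = t'') \<Longrightarrow>
      \<exists>x\<in>I. of_bool (w t x = 1) + of_bool (w t' x = 2) + of_bool (w t'' x = 3) = (2::nat)"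
  shows "\<exists>\<alpha> \<beta> \<gamma> :: nat \<Rightarrow> nat \<times> nat \<times> nat \<Rightarrow> complex.
    bilinear_algorithm r ((m - 1) ^ D) (m ^ card I) \<alpha> \<beta> \<gamma>"
proof -
  let ?N = "(m - 1) ^ D"
  \<comment> \<open>A matrix index is written as a string of \<open>D\<close> nonzero residues, one
    for each position carrying the letter \<open>a\<close>. Excluding the residue 0 is what makes
    the size a power of \<open>m - 1\<close> and keeps an entry from vanishing on its own
    letters.\<close>
  let ?E = "\<lambda>t a. {x\<in>I. w t x = a} \<rightarrow>\<^sub>E {1..<m}"
  define e where "e t a = (SOME e. bij_betw e {..<?N} (?E t a))" for t a
  have e: "bij_betw (e t a) {..<?N} (?E t a)" if "t < r" "a \<in> {1, 2, 3}" for t a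
  proof -
    have "finite {x\<in>I. w t x = a}" using I by simp
    then have "finite (?E t a)" "card (?E t a) = ?N"
      using count[OF that] by (simp_all add: card_PiE finite_PiE)
    then have "\<exists>e. bij_betw e {..<?N} (?E t a)"
      using ex_bij_betw_nat_finite[of "?E t a"] by (simp add: lessThan_atLeast0)
    then show ?thesis unfolding e_def by (rule someI_ex)
  qed
  define d where "d t a i x = (if w t x = a then int (e t a i x) else 0)" for t a i x
  have d0: "d t a i x = 0" if "w t x \<noteq> a" for t a i x
    using that by (simp add: d_def)
  have d_range: "0 < d t a i x" "d t a i x < int m"
    if "t < r" "a \<in> {1, 2, 3}" "i < ?N" "x \<in> I" "w t x = a" for t a i x
  proof -
    have "e t a i \<in> ?E t a" using bij_betw_apply[OF e[OF that(1,2)]] that(3) by simp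
    from PiE_mem[OF this, of x] have "e t a i x \<in> {1..<m}" using that by simp
    then show "0 < d t a i x" "d t a i x < int m" using that by (auto simp: d_def)
  qed
  have d_not_dvd: "\<not> int m dvd d t a i x" "\<not> int m dvd - d t a i x"
    if "t < r" "a \<in> {1, 2, 3}" "i < ?N" "x \<in> I" "w t x = a" for t a i x
  proof -
    show "\<not> int m dvd d t a i x"
      using d_range[OF that] zdvd_imp_le[of "int m" "d t a i x"] by linarith
    then show "\<not> int m dvd - d t a i x" by simp
  qed
  have d_inj: "i = i'"
    if ta: "t < r" "a \<in> {1, 2, 3}" and ii: "i < ?N" "i' < ?N"
      and dvd: "\<And>x. x \<in> I \<Longrightarrow> w t x = a \<Longrightarrow> int m dvd d t a i x - d t a i' x" for t a i i'
  proof -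
    have eq: "e t a i x = e t a i' x" if x: "x \<in> {x\<in>I. w t x = a}" for x
    proof -
      have x': "x \<in> I" "w t x = a" using x by auto
      note r = d_range[OF ta ii(1) x'] d_range[OF ta ii(2) x']
      \<comment> \<open>Both residues lie strictly between 0 and \<open>m\<close>, so a difference
        divisible by \<open>m\<close> is 0.\<close>
      have "d t a i x - d t a i' x = 0"
      proof (rule ccontr)
        assume "d t a i x - d t a i' x \<noteq> 0"
        from dvd_imp_le_int[OF this dvd[OF x']] show False using r by linarith
      qed
      then show ?thesis using x' by (simp add: d_def)
    qed
    have mem: "e t a i \<in> ?E t a" "e t a i' \<in> ?E t a"
      using bij_betw_apply[OF e[OF ta]] ii by simp_all
    have "e t a i = e t a i'" by (rule PiE_ext[OF mem eq])
    then show ?thesis by (rule inj_onD[OF bij_betw_imp_inj_on[OF e[OF ta]]]) (use ii in simp_all)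
  qed
  show ?thesis
  \<comment> \<open>Row indices live on the letters 2, column indices on the letters 1, and
    summation indices on the letters 3. Each index occurs in two of the three elements with opposite
    signs, so matching indices cancel.\<close>
  proof (rule bilinear_algorithm_of_group_embedding[OF I m, where
        gX = "\<lambda>(t, i, k) x. d t 2 i x - d t 3 k x" and
        gY = "\<lambda>(t, k, j) x. d t 3 k x - d t 1 j x" and
        gZ = "\<lambda>(t, i, j) x. d t 1 j x - d t 2 i x"], simp only: prod.case)
    fix t t' t'' i i' j j' k k'
    assume t: "t < r" "t' < r" "t'' < r"
      and i: "i < ?N" "i' < ?N" "j < ?N" "j' < ?N" "k < ?N" "k' < ?N"
    let ?g = "\<lambda>x. d t 2 i x - d t 3 k x + (d t' 3 k' x - d t' 1 j x) + (d t'' 1 j' x - d t'' 2 i' x)"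
    show "(\<forall>x\<in>I. int m dvd ?g x) \<longleftrightarrow> t = t' \<and> t' = t'' \<and> i = i' \<and> j = j' \<and> k = k'"
    proof
      assume dvd: "\<forall>x\<in>I. int m dvd ?g x"
      have eq: "t = t' \<and> t' = t''"
      proof (rule ccontr)
        assume "\<not> ?thesis"
        from separated[OF t this] obtain x where x: "x \<in> I"
          and two: "of_bool (w t x = 1) + of_bool (w t' x = 2) + of_bool (w t'' x = 3) = (2::nat)"
          by blast
        have g: "int m dvd ?g x" using dvd x by blast
        consider "w t x = 1" "w t' x = 2" "w t'' x \<noteq> 3" | "w t x = 1" "w t' x \<noteq> 2" "w t'' x = 3"
          | "w t x \<noteq> 1" "w t' x = 2" "w t'' x = 3"
          using two by (cases "w t x = 1"; cases "w t' x = 2"; cases "w t'' x = 3") simp_all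
        then show False
        proof cases
          case c1: 1
          from letters[OF t(3) x] consider "w t'' x = 1" | "w t'' x = 2" using c1 by auto
          then show False
          proof cases
            case 1
            have eqg: "?g x = d t'' 1 j' x" using 1 c1 by (simp add: d0)
            show False using g d_not_dvd(1)[OF t(3) _ i(4) x 1] unfolding eqg by simp
          next
            case 2
            have eqg: "?g x = - d t'' 2 i' x" using 2 c1 by (simp add: d0)
            show False using g d_not_dvd(2)[OF t(3) _ i(2) x 2] unfolding eqg by simp
          qed
        next
          case c2: 2
          from letters[OF t(2) x] consider "w t' x = 1" | "w t' x = 3" using c2 by auto
          then show False
          proof cases
            case 1
            have eqg: "?g x = - d t' 1 j x" using 1 c2 by (simp add: d0)
            show False using g d_not_dvd(2)[OF t(2) _ i(3) x 1] unfolding eqg by simp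
          next
            case 2
            have eqg: "?g x = d t' 3 k' x" using 2 c2 by (simp add: d0)
            show False using g d_not_dvd(1)[OF t(2) _ i(6) x 2] unfolding eqg by simp
          qed
        next
          case c3: 3
          from letters[OF t(1) x] consider "w t x = 2" | "w t x = 3" using c3 by auto
          then show False
          proof cases
            case 1
            have eqg: "?g x = d t 2 i x" using 1 c3 by (simp add: d0)
            show False using g d_not_dvd(1)[OF t(1) _ i(1) x 1] unfolding eqg by simp
          next
            case 2
            have eqg: "?g x = - d t 3 k x" using 2 c3 by (simp add: d0)
            show False using g d_not_dvd(2)[OF t(1) _ i(5) x 2] unfolding eqg by simp
          qed
        qed
      qed
      \<comment> \<open>The three words now coincide, so at a letter 2 only the terms of
        \<open>i\<close> and \<open>i'\<close> survive; the letters 1 and 3 settle the other two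
        indices in the same way.\<close>
      have "i = i'"
      proof (rule d_inj[OF t(1), of 2 i i'])
        fix x assume x: "x \<in> I" "w t x = 2"
        have eqg: "?g x = d t 2 i x - d t 2 i' x" using x(2) eq by (simp add: d0)
        show "int m dvd d t 2 i x - d t 2 i' x" unfolding eqg[symmetric] using dvd x(1) by blast
      qed (use i in simp_all)
      moreover have "j' = j"
      proof (rule d_inj[OF t(1), of 1 j' j])
        fix x assume x: "x \<in> I" "w t x = 1"
        have eqg: "?g x = d t 1 j' x - d t 1 j x" using x(2) eq by (simp add: d0)
        show "int m dvd d t 1 j' x - d t 1 j x" unfolding eqg[symmetric] using dvd x(1) by blast
      qed (use i in simp_all)
      moreover have "k' = k"
      proof (rule d_inj[OF t(1), of 3 k' k])
        fix x assume x: "x \<in> I" "w t x = 3"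
        have eqg: "?g x = d t 3 k' x - d t 3 k x" using x(2) eq by (simp add: d0)
        show "int m dvd d t 3 k' x - d t 3 k x" unfolding eqg[symmetric] using dvd x(1) by blast
      qed (use i in simp_all)
      ultimately show "t = t' \<and> t' = t'' \<and> i = i' \<and> j = j' \<and> k = k'" using eq by simp
    next
      assume eq: "t = t' \<and> t' = t'' \<and> i = i' \<and> j = j' \<and> k = k'"
      have "?g x = 0" for x using eq by simp
      then show "\<forall>x\<in>I. int m dvd ?g x" by (simp only: dvd_0_right) simp
    qed
  qed
qed

text \<open>A permutation of \<open>U\<close> only rearranges the pairs \<open>(u, i)\<close>, so
  every word has the letter counts of \<open>U\<close> itself and all products get the same size.
  Words of three permutations that are not all equal are separated by the very definition of a
  strong USP.\<close>

lemma bilinear_algorithm_of_strong_USP: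
  assumes U: "strong_USP k U" and m: "0 < m"
    and count: "\<And>a. a \<in> {1, 2, 3} \<Longrightarrow> card {(u, i) \<in> U \<times> {1..k}. u i = a} = D"
  shows "\<exists>\<alpha> \<beta> \<gamma> :: nat \<Rightarrow> nat \<times> nat \<times> nat \<Rightarrow> complex.
    bilinear_algorithm (fact (card U)) ((m - 1) ^ D) (m ^ (card U * k)) \<alpha> \<beta> \<gamma>"
proof -
  have sub: "U \<subseteq> {1..k} \<rightarrow>\<^sub>E {1, 2, 3}" using U by (simp add: strong_USP_def)
  then have fin: "finite U" by (rule finite_subset) (simp add: finite_PiE)
  let ?S = "{\<pi>. \<pi> permutes U}"
  have "finite ?S" "card ?S = fact (card U)"
    by (rule finite_permutations[OF fin], rule card_permutations[OF refl fin])
  then obtain \<pi> where \<pi>: "bij_betw \<pi> {..<fact (card U) :: nat} ?S"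
    using ex_bij_betw_nat_finite[of ?S] unfolding lessThan_atLeast0 by force
  have perm: "\<pi> t permutes U" if "t < fact (card U)" for t
    using bij_betw_apply[OF \<pi>] that by simp
  let ?w = "\<lambda>t (u, i). \<pi> t u i"
  have "\<exists>\<alpha> \<beta> \<gamma> :: nat \<Rightarrow> nat \<times> nat \<times> nat \<Rightarrow> complex.
    bilinear_algorithm (fact (card U)) ((m - 1) ^ D) (m ^ card (U \<times> {1..k})) \<alpha> \<beta> \<gamma>"
  proof (rule bilinear_algorithm_of_words[of _ m _ ?w])
    show "?w t x \<in> {1, 2, 3}" if t: "t < fact (card U)" and xI: "x \<in> U \<times> {1..k}" for t x
    proof -
      obtain u i where x: "x = (u, i)" "u \<in> U" "i \<in> {1..k}" using xI by blast
      then have "\<pi> t u \<in> U" using permutes_in_image[OF perm[OF t]] by blast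
      then have "\<pi> t u \<in> {1..k} \<rightarrow>\<^sub>E {1, 2, 3}" using sub by blast
      from PiE_mem[OF this x(3)] have "\<pi> t u i \<in> {1, 2, 3}" .
      then show ?thesis by (simp add: x(1))
    qed
    show "card {x \<in> U \<times> {1..k}. ?w t x = a} = D" if t: "t < fact (card U)" and a: "a \<in> {1, 2, 3}" for t a
    proof -
      have "bij_betw (map_prod (\<pi> t) id) {x \<in> U \<times> {1..k}. ?w t x = a} {(u, i) \<in> U \<times> {1..k}. u i = a}"
      proof (rule bij_betwI[of _ _ _ "map_prod (inv_into UNIV (\<pi> t)) id"])
        show "map_prod (\<pi> t) id \<in> Pi {x \<in> U \<times> {1..k}. ?w t x = a} (\<lambda>_. {(u, i) \<in> U \<times> {1..k}. u i = a})"
          by (auto simp: permutes_in_image[OF perm[OF t]])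
        show "map_prod (inv_into UNIV (\<pi> t)) id \<in> Pi {(u, i) \<in> U \<times> {1..k}. u i = a} (\<lambda>_. {x \<in> U \<times> {1..k}. ?w t x = a})"
          by (auto simp: permutes_in_image[OF permutes_inv[OF perm[OF t]]]
              permutes_inverses(1)[OF perm[OF t]])
      qed (auto simp: permutes_inverses[OF perm[OF t]])
      from bij_betw_same_card[OF this] show ?thesis using count[OF a] by (rule trans)
    qed
    show "\<exists>x\<in>U \<times> {1..k}. of_bool (?w t x = 1) + of_bool (?w t' x = 2) + of_bool (?w t'' x = 3) = (2::nat)"
      if t: "t < fact (card U)" "t' < fact (card U)" "t'' < fact (card U)" "\<not> (t = t' \<and> t' = t'')"
      for t t' t''
    proof -
      have "\<not> (\<pi> t = \<pi> t' \<and> \<pi> t' = \<pi> t'')"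
        using t by (simp add: inj_on_eq_iff[OF bij_betw_imp_inj_on[OF \<pi>]])
      then obtain u i where "u \<in> U" "i \<in> {1..k}"
        "of_bool (\<pi> t u i = 1) + of_bool (\<pi> t' u i = 2) + of_bool (\<pi> t'' u i = 3) = (2::nat)"
        using U[unfolded strong_USP_def, THEN conjunct2, rule_format,
            OF perm[OF t(1)] perm[OF t(2)] perm[OF t(3)]] by blast
      then show ?thesis by (intro bexI[of _ "(u, i)"]) auto
    qed
  qed (use fin m in simp_all)
  then show ?thesis by (simp add: card_cartesian_product)
qed

section \<open>A family of strong uniquely solvable puzzles\<close>

definition triangle :: "nat \<Rightarrow> (nat \<times> nat \<times> nat) set" where
  "triangle K = {(a, b, c). a + b + c = 2 ^ K - 1}"

text \<open>Each alphabet lacks one letter, so "exactly two" turns into "both of the remaining two".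
  For \<open>q = 0\<close> it says that a bit of the first coordinate is set under
  \<open>\<pi>1\<close> and not set under \<open>\<pi>2\<close>. If this never happens, the binary
  digits of the one number are contained in those of the other, which gives an inequality between
  the numbers. The cyclic choice of alphabets yields such inequalities from \<open>\<pi>1\<close> to
  \<open>\<pi>2\<close>, from \<open>\<pi>2\<close> to \<open>\<pi>3\<close> and from
  \<open>\<pi>3\<close> to \<open>\<pi>1\<close>.\<close>

definition letter :: "nat \<times> nat \<times> nat \<Rightarrow> nat \<Rightarrow> nat \<Rightarrow> nat" where
  "letter = (\<lambda>(a, b, c) q r.
     if q = 0 then if r \<in> set_decode a then 1 else 2
     else if q = 1 then if r \<in> set_decode b then 2 else 3
     else if r \<in> set_decode c then 3 else 1)"

lemma letter_eq_iff:
  "letter (a, b, c) 0 r = 1 \<longleftrightarrow> r \<in> set_decode a"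
  "letter (a, b, c) 0 r = 2 \<longleftrightarrow> r \<notin> set_decode a"
  "letter (a, b, c) 0 r = 3 \<longleftrightarrow> False"
  "letter (a, b, c) 1 r = 1 \<longleftrightarrow> False"
  "letter (a, b, c) 1 r = 2 \<longleftrightarrow> r \<in> set_decode b"
  "letter (a, b, c) 1 r = 3 \<longleftrightarrow> r \<notin> set_decode b"
  "letter (a, b, c) 2 r = 1 \<longleftrightarrow> r \<notin> set_decode c"
  "letter (a, b, c) 2 r = 2 \<longleftrightarrow> False"
  "letter (a, b, c) 2 r = 3 \<longleftrightarrow> r \<in> set_decode c"
  by (simp_all add: letter_def)

text \<open>Bits are numbered from 0 and word positions from 1, hence the shift.\<close>

definition triangle_word :: "nat \<Rightarrow> nat \<times> nat \<times> nat \<Rightarrow> nat \<Rightarrow> nat" where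
  "triangle_word K p = restrict (\<lambda>i. letter p ((i - 1) div K) ((i - 1) mod K)) {1..3 * K}"

lemma triangle_word_nth:
  assumes "q < 3" "r < K"
  shows "triangle_word K p (Suc (q * K + r)) = letter p q r"
proof -
  have "q * K + r < (q + 1) * K" using assms by simp
  also have "\<dots> \<le> 3 * K" using assms(1) by (intro mult_le_mono1) simp
  finally have "q * K + r < 3 * K" .
  then show ?thesis using assms by (simp add: triangle_word_def)
qed

lemma triangle_word_in_PiE: "triangle_word K p \<in> {1..3 * K} \<rightarrow>\<^sub>E {1, 2, 3}"
  by (auto simp: triangle_word_def letter_def split: prod.split)

lemma set_decode_subset: "a < 2 ^ K \<Longrightarrow> set_decode a \<subseteq> {..<K}"
proof
  fix i assume "a < 2 ^ K" and i: "i \<in> set_decode a"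
  have "2 ^ i \<le> a"
  proof (rule ccontr)
    assume "\<not> 2 ^ i \<le> a"
    then have "a div 2 ^ i = 0" by simp
    then show False using i by (simp add: set_decode_def)
  qed
  with \<open>a < 2 ^ K\<close> have "(2::nat) ^ i < 2 ^ K" by linarith
  then show "i \<in> {..<K}" by simp
qed

lemma set_decode_le:
  assumes "a < 2 ^ K" "\<And>i. i < K \<Longrightarrow> i \<in> set_decode a \<Longrightarrow> i \<in> set_decode b"
  shows "a \<le> b"
  by (rule subset_decode_imp_le) (use assms set_decode_subset in blast)

lemma triangle_less:
  assumes "(a, b, c) \<in> triangle K"
  shows "a < 2 ^ K \<and> b < 2 ^ K \<and> c < 2 ^ K"
proof -
  have "a + b + c = 2 ^ K - 1" "1 \<le> (2::nat) ^ K" using assms by (simp_all add: triangle_def)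
  then show ?thesis by linarith
qed

lemma inj_on_triangle_word: "inj_on (triangle_word K) (triangle K)"
proof (rule inj_onI)
  fix p p' assume p: "p \<in> triangle K" "p' \<in> triangle K" and eq: "triangle_word K p = triangle_word K p'"
  obtain a b c a' b' c' where abc: "p = (a, b, c)" "p' = (a', b', c')" by (metis prod_cases3)
  have letters: "letter p q r = letter p' q r" if "q < 3" "r < K" for q r
    using triangle_word_nth[OF that] eq by metis
  have bits: "r \<in> set_decode a \<longleftrightarrow> r \<in> set_decode a'" "r \<in> set_decode b \<longleftrightarrow> r \<in> set_decode b'"
    "r \<in> set_decode c \<longleftrightarrow> r \<in> set_decode c'" if "r < K" for r
    using letters[OF _ that, of 0] letters[OF _ that, of 1] letters[OF _ that, of 2]
      letter_eq_iff(1,5,9)[of a b c r] letter_eq_iff(1,5,9)[of a' b' c' r]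
    by (simp_all add: abc)
  note less = triangle_less[of a b c K] triangle_less[of a' b' c' K]
  have "a = a'" "b = b'" "c = c'"
    using less p bits unfolding abc by (intro antisym set_decode_le[of _ K]; simp)+
  then show "p = p'" by (simp add: abc)
qed

text \<open>Permutations preserve the sum of each coordinate, so the inequalities are equalities. The
  deficit \<open>d\<close> of the common coordinates then satisfies \<open>\<Sum>d\<^sup>2 = 0\<close>, because permutations also
  preserve the sum of the squares of each coordinate.\<close>

lemma permuted_triples_agree:
  fixes A B C :: "'u \<Rightarrow> nat"
  assumes U: "finite U" and perm: "\<pi>1 permutes U" "\<pi>2 permutes U" "\<pi>3 permutes U"
    and total: "\<And>u. u \<in> U \<Longrightarrow> A u + B u + C u = S"
    and le: "\<And>u. u \<in> U \<Longrightarrow> A (\<pi>1 u) \<le> A (\<pi>2 u)" "\<And>u. u \<in> U \<Longrightarrow> B (\<pi>2 u) \<le> B (\<pi>3 u)"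
      "\<And>u. u \<in> U \<Longrightarrow> C (\<pi>3 u) \<le> C (\<pi>1 u)"
    and u: "u \<in> U"
  shows "A (\<pi>1 u) = A (\<pi>2 u) \<and> A (\<pi>2 u) = A (\<pi>3 u) \<and> B (\<pi>1 u) = B (\<pi>2 u) \<and> B (\<pi>2 u) = B (\<pi>3 u) \<and>
    C (\<pi>1 u) = C (\<pi>2 u) \<and> C (\<pi>2 u) = C (\<pi>3 u)"
proof -
  have sum_perm: "(\<Sum>u\<in>U. f (\<pi> u)) = (\<Sum>u\<in>U. f u)" if "\<pi> permutes U" for \<pi> and f :: "'u \<Rightarrow> 'v::comm_monoid_add"
    using sum.permute[OF that, of f] by (simp add: o_def)
  have eq_pointwise: "f (\<pi> v) = f (\<pi>' v)"
    if "\<pi> permutes U" "\<pi>' permutes U" "\<And>u. u \<in> U \<Longrightarrow> f (\<pi> u) \<le> f (\<pi>' u)" "v \<in> U"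
    for \<pi> \<pi>' v and f :: "'u \<Rightarrow> nat"
  proof (rule sum_mono_inv[of "\<lambda>u. f (\<pi> u)" U "\<lambda>u. f (\<pi>' u)"])
    show "(\<Sum>u\<in>U. f (\<pi> u)) = (\<Sum>u\<in>U. f (\<pi>' u))"
      by (simp only: sum_perm[OF that(1)] sum_perm[OF that(2)])
  qed (use that U in auto)
  have in_U: "\<pi> v \<in> U" if "v \<in> U" "\<pi> permutes U" for \<pi> v
    using that by (simp add: permutes_in_image)
  have eqs: "A (\<pi>1 v) = A (\<pi>2 v)" "B (\<pi>2 v) = B (\<pi>3 v)" "C (\<pi>3 v) = C (\<pi>1 v)" if "v \<in> U" for v
    using eq_pointwise[OF perm(1,2) le(1) that] eq_pointwise[OF perm(2,3) le(2) that]
      eq_pointwise[OF perm(3,1) le(3) that] by auto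
  \<comment> \<open>Each of the three triples has the common coordinates
    \<open>A (\<pi>2 v)\<close>, \<open>B (\<pi>3 v)\<close>, \<open>C (\<pi>1 v)\<close> except in
    one place, and the fixed total forces the excess there to be the same
    \<open>d v\<close>.\<close>
  define d where "d v = int S - int (A (\<pi>2 v)) - int (B (\<pi>3 v)) - int (C (\<pi>1 v))" for v
  have dA: "int (A (\<pi>3 v)) = int (A (\<pi>2 v)) + d v"
    and dB: "int (B (\<pi>1 v)) = int (B (\<pi>3 v)) + d v"
    and dC: "int (C (\<pi>2 v)) = int (C (\<pi>1 v)) + d v" if "v \<in> U" for v
    using total[OF in_U[OF that perm(1)]] total[OF in_U[OF that perm(2)]]
      total[OF in_U[OF that perm(3)]] eqs[OF that]
    by (simp_all add: d_def)
  have sq: "(\<Sum>v\<in>U. (int (f (\<pi> v)))\<^sup>2 - (int (f (\<pi>' v)))\<^sup>2) = 0"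
    if "\<pi> permutes U" "\<pi>' permutes U" for \<pi> \<pi>' and f :: "'u \<Rightarrow> nat"
    using sum_perm[OF that(1), of "\<lambda>u. (int (f u))\<^sup>2"] sum_perm[OF that(2), of "\<lambda>u. (int (f u))\<^sup>2"]
    by (simp add: sum_subtractf)
  have lin: "(\<Sum>v\<in>U. d v) = 0"
  proof -
    have "(\<Sum>v\<in>U. d v) = (\<Sum>v\<in>U. int (A (\<pi>3 v)) - int (A (\<pi>2 v)))"
      by (rule sum.cong[OF refl]) (simp add: dA)
    then show ?thesis
      using sum_perm[OF perm(3), of "\<lambda>u. int (A u)"] sum_perm[OF perm(2), of "\<lambda>u. int (A u)"]
      by (simp add: sum_subtractf)
  qed
  \<comment> \<open>Adding \<open>(x + d)^2 - x^2\<close> over the three coordinates, whose common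
    values sum to \<open>S - d\<close>, gives
    \<open>2 * d * (S - d) + 3 * d^2 = 2 * S * d + d^2\<close>. Summed over \<open>U\<close> the
    differences of squares vanish, and so does the linear term, by \<open>lin\<close>.\<close>
  have "(\<Sum>v\<in>U. (d v)\<^sup>2) = (\<Sum>v\<in>U. ((int (A (\<pi>3 v)))\<^sup>2 - (int (A (\<pi>2 v)))\<^sup>2) +
     ((int (B (\<pi>1 v)))\<^sup>2 - (int (B (\<pi>3 v)))\<^sup>2) + ((int (C (\<pi>2 v)))\<^sup>2 - (int (C (\<pi>1 v)))\<^sup>2) - 2 * int S * d v)"
  proof (rule sum.cong[OF refl])
    fix v assume v: "v \<in> U"
    have S: "int S = int (A (\<pi>2 v)) + int (B (\<pi>3 v)) + int (C (\<pi>1 v)) + d v" by (simp add: d_def)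
    show "(d v)\<^sup>2 = ((int (A (\<pi>3 v)))\<^sup>2 - (int (A (\<pi>2 v)))\<^sup>2) +
     ((int (B (\<pi>1 v)))\<^sup>2 - (int (B (\<pi>3 v)))\<^sup>2) + ((int (C (\<pi>2 v)))\<^sup>2 - (int (C (\<pi>1 v)))\<^sup>2) - 2 * int S * d v"
      unfolding dA[OF v] dB[OF v] dC[OF v] S by (simp add: power2_eq_square algebra_simps)
  qed
  also have "\<dots> = 0"
    using sq[OF perm(3,2)] sq[OF perm(1,3)] sq[OF perm(2,1)] lin
    by (simp add: sum_subtractf sum.distrib sum_distrib_left[symmetric])
  finally have "\<forall>v\<in>U. (d v)\<^sup>2 = 0" using U by (simp add: sum_nonneg_eq_0_iff)
  then have "d u = 0" using u by simp
  then show ?thesis using dA[OF u] dB[OF u] dC[OF u] eqs[OF u] by simp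
qed

theorem strong_USP_triangle: "strong_USP (3 * K) (triangle_word K ` triangle K)"
proof -
  let ?U = "triangle_word K ` triangle K"
  have sub: "?U \<subseteq> {1..3 * K} \<rightarrow>\<^sub>E {1, 2, 3}" using triangle_word_in_PiE by blast
  then have fin: "finite ?U" by (rule finite_subset) (simp add: finite_PiE)
  define p where "p u = inv_into (triangle K) (triangle_word K) u" for u
  have p: "p u \<in> triangle K" "triangle_word K (p u) = u" if "u \<in> ?U" for u
    unfolding p_def by (rule inv_into_into[OF that], rule f_inv_into_f[OF that])
  define A where "A u = fst (p u)" for u
  define B where "B u = fst (snd (p u))" for u
  define C where "C u = snd (snd (p u))" for u
  have p_eq: "p u = (A u, B u, C u)" for u by (simp add: A_def B_def C_def)
  have total: "A u + B u + C u = 2 ^ K - 1" if "u \<in> ?U" for u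
    using p(1)[OF that] by (simp add: p_eq triangle_def)
  have less: "A u < 2 ^ K" "B u < 2 ^ K" "C u < 2 ^ K" if "u \<in> ?U" for u
    using triangle_less[OF p(1)[OF that, unfolded p_eq]] by simp_all
  have nth: "u (Suc (q * K + r)) = letter (A u, B u, C u) q r" if "u \<in> ?U" "q < 3" "r < K" for u q r
    using triangle_word_nth[OF that(2,3), of "p u"] p(2)[OF that(1)] by (simp add: p_eq)
  have main: "\<pi>1 = \<pi>2 \<and> \<pi>2 = \<pi>3"
    if perm: "\<pi>1 permutes ?U" "\<pi>2 permutes ?U" "\<pi>3 permutes ?U"
      and no: "\<not> (\<exists>u\<in>?U. \<exists>i\<in>{1..3 * K}.
        of_bool (\<pi>1 u i = 1) + of_bool (\<pi>2 u i = 2) + of_bool (\<pi>3 u i = 3) = (2::nat))"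
    for \<pi>1 \<pi>2 \<pi>3
  proof -
    have in_U: "\<pi>1 u \<in> ?U" "\<pi>2 u \<in> ?U" "\<pi>3 u \<in> ?U" if "u \<in> ?U" for u
      using that by (simp_all only: permutes_in_image[OF perm(1)] permutes_in_image[OF perm(2)]
          permutes_in_image[OF perm(3)])
    have not_two: "of_bool (letter (p (\<pi>1 u)) q r = 1) + of_bool (letter (p (\<pi>2 u)) q r = 2) +
        of_bool (letter (p (\<pi>3 u)) q r = 3) \<noteq> (2::nat)" if "u \<in> ?U" "q < 3" "r < K" for u q r
    proof -
      have "q * K + r < (q + 1) * K" using that by simp
      also have "\<dots> \<le> 3 * K" using that(2) by (intro mult_le_mono1) simp
      finally have "Suc (q * K + r) \<in> {1..3 * K}" by simp
      then have "of_bool (\<pi>1 u (Suc (q * K + r)) = 1) + of_bool (\<pi>2 u (Suc (q * K + r)) = 2) +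
          of_bool (\<pi>3 u (Suc (q * K + r)) = 3) \<noteq> (2::nat)"
        using no that(1) by blast
      then show ?thesis
        unfolding nth[OF in_U(1)[OF that(1)] that(2,3)] nth[OF in_U(2)[OF that(1)] that(2,3)]
          nth[OF in_U(3)[OF that(1)] that(2,3)] p_eq .
    qed
    have le1: "A (\<pi>1 u) \<le> A (\<pi>2 u)" if u: "u \<in> ?U" for u
    proof (rule set_decode_le[OF less(1)[OF in_U(1)[OF u]]])
      fix r assume "r < K" "r \<in> set_decode (A (\<pi>1 u))"
      then show "r \<in> set_decode (A (\<pi>2 u))"
        using not_two[OF u, of 0 r] unfolding p_eq letter_eq_iff
        by (cases "r \<in> set_decode (A (\<pi>2 u))") simp_all
    qed
    have le2: "B (\<pi>2 u) \<le> B (\<pi>3 u)" if u: "u \<in> ?U" for u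
    proof (rule set_decode_le[OF less(2)[OF in_U(2)[OF u]]])
      fix r assume "r < K" "r \<in> set_decode (B (\<pi>2 u))"
      then show "r \<in> set_decode (B (\<pi>3 u))"
        using not_two[OF u, of 1 r] unfolding p_eq letter_eq_iff
        by (cases "r \<in> set_decode (B (\<pi>3 u))") simp_all
    qed
    have le3: "C (\<pi>3 u) \<le> C (\<pi>1 u)" if u: "u \<in> ?U" for u
    proof (rule set_decode_le[OF less(3)[OF in_U(3)[OF u]]])
      fix r assume "r < K" "r \<in> set_decode (C (\<pi>3 u))"
      then show "r \<in> set_decode (C (\<pi>1 u))"
        using not_two[OF u, of 2 r] unfolding p_eq letter_eq_iff
        by (cases "r \<in> set_decode (C (\<pi>1 u))") simp_all
    qed
    have agree: "A (\<pi>1 u) = A (\<pi>2 u) \<and> A (\<pi>2 u) = A (\<pi>3 u) \<and> B (\<pi>1 u) = B (\<pi>2 u) \<and>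
      B (\<pi>2 u) = B (\<pi>3 u) \<and> C (\<pi>1 u) = C (\<pi>2 u) \<and> C (\<pi>2 u) = C (\<pi>3 u)" if "u \<in> ?U" for u
      by (rule permuted_triples_agree[of ?U \<pi>1 \<pi>2 \<pi>3 A B C "2 ^ K - 1" u,
            OF fin perm total le1 le2 le3 that])
    have pointwise: "\<pi>1 u = \<pi>2 u \<and> \<pi>2 u = \<pi>3 u" for u
    proof (cases "u \<in> ?U")
      case True
      have "p (\<pi>1 u) = p (\<pi>2 u)" "p (\<pi>2 u) = p (\<pi>3 u)" using agree[OF True] by (simp_all add: p_eq)
      then show ?thesis
        using p(2)[OF in_U(1)[OF True]] p(2)[OF in_U(2)[OF True]] p(2)[OF in_U(3)[OF True]]
        by (metis (no_types))
    next
      case False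
      then show ?thesis by (simp only: permutes_not_in[OF perm(1)] permutes_not_in[OF perm(2)]
            permutes_not_in[OF perm(3)] simp_thms)
    qed
    show ?thesis
      by (rule conjI; rule ext) (rule conjunct1[OF pointwise], rule conjunct2[OF pointwise])
  qed
  show ?thesis
    unfolding strong_USP_def by (intro conjI[OF sub] allI impI disjCI) (rule main)
qed

section \<open>Size and letter counts of the puzzle\<close>

lemma finite_triangle: "finite (triangle K)"
proof (rule finite_subset)
  show "triangle K \<subseteq> {..<2 ^ K} \<times> {..<2 ^ K} \<times> {..<2 ^ K}"
  proof
    fix x assume x: "x \<in> triangle K"
    obtain a b c where "x = (a, b, c)" by (rule prod_cases3)
    then show "x \<in> {..<2 ^ K} \<times> {..<2 ^ K} \<times> {..<2 ^ K}" using x triangle_less by simp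
  qed
qed simp

lemma card_triangle: "2 * card (triangle K) = 2 ^ K * (2 ^ K + 1)"
proof -
  have "bij_betw (\<lambda>(a, b). (a, b, 2 ^ K - 1 - a - b)) (SIGMA a:{..<2 ^ K}. {..<2 ^ K - a}) (triangle K)"
  proof (rule bij_betwI[of _ _ _ "\<lambda>(a, b, c). (a, b)"])
    show "(\<lambda>(a, b, c). (a, b)) \<in> Pi (triangle K) (\<lambda>_. SIGMA a:{..<2 ^ K}. {..<2 ^ K - a})"
    proof
      fix x assume "x \<in> triangle K"
      moreover obtain a b c where x: "x = (a, b, c)" by (rule prod_cases3)
      ultimately have "a + b + c = 2 ^ K - 1" by (simp add: triangle_def)
      moreover have "1 \<le> (2::nat) ^ K" by simp
      ultimately have "a < 2 ^ K" "b < 2 ^ K - a" by linarith+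
      then show "(case x of (a, b, c) \<Rightarrow> (a, b)) \<in> (SIGMA a:{..<2 ^ K}. {..<2 ^ K - a})"
        by (simp add: x)
    qed
  qed (auto simp: triangle_def)
  from bij_betw_same_card[OF this] have "card (triangle K) = (\<Sum>a<2 ^ K. 2 ^ K - a)"
    by (simp add: card_SigmaI)
  also have "2 * (\<Sum>a<n. n - a) = n * (n + 1)" for n :: nat
  proof (induction n)
    case (Suc n)
    have "(\<Sum>a<Suc n. Suc n - a) = Suc n + (\<Sum>a<n. n - a)"
      by (subst sum.lessThan_Suc_shift) simp
    then show ?case using Suc by simp
  qed simp
  finally show ?thesis .
qed

lemma card_triangle_words: "card (triangle_word K ` triangle K) = card (triangle K)"
  by (rule card_image[OF inj_on_triangle_word])

lemma card_triangle_word_letter: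
  "card {i \<in> {1..3 * K}. triangle_word K p i = l} = (\<Sum>q<3. \<Sum>r<K. of_bool (letter p q r = l))"
proof -
  have "card {i \<in> {1..3 * K}. triangle_word K p i = l} = (\<Sum>i\<in>{1..3 * K}. of_bool (triangle_word K p i = l))"
    by (simp add: Int_def)
  also have "\<dots> = (\<Sum>i<3 * K. of_bool (triangle_word K p (Suc i) = l))"
    by (simp add: sum.atLeast1_atMost_eq)
  also have "\<dots> = (\<Sum>q<3. \<Sum>r<K. of_bool (triangle_word K p (Suc (q * K + r)) = l))"
    by (rule sum_blocks[symmetric])
  also have "\<dots> = (\<Sum>q<3. \<Sum>r<K. of_bool (letter p q r = l))"
    by (intro sum.cong refl) (simp add: triangle_word_nth)
  finally show ?thesis .
qed

text \<open>Each letter marks the set bits of one coordinate and the unset bits of another, so a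
  triple contains it \<open>K\<close> times, plus the difference of two digit sums. The triangle is
  symmetric under permuting coordinates, so these differences cancel in the total.\<close>

lemma count_triangle_letters:
  assumes "l \<in> {1, 2, 3}"
  shows "card {(u, i) \<in> triangle_word K ` triangle K \<times> {1..3 * K}. u i = l} = card (triangle K) * K"
proof -
  define pop :: "nat \<Rightarrow> nat" where "pop x = (\<Sum>r<K. of_bool (r \<in> set_decode x))" for x
  have copop: "(\<Sum>r<K. of_bool (r \<notin> set_decode x)) + pop x = K" for x
  proof -
    have "(\<Sum>r<K. of_bool (r \<notin> set_decode x)) + pop x = (\<Sum>r<K. 1)"
      unfolding pop_def sum.distrib[symmetric] by (rule sum.cong[OF refl]) simp
    then show ?thesis by simp
  qed
  let ?T = "triangle K"
  let ?n = "\<lambda>p. \<Sum>q<3. \<Sum>r<K. of_bool (letter p q r = l)"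
  have swap: "(\<Sum>(a, b, c)\<in>?T. pop a) = (\<Sum>(a, b, c)\<in>?T. pop b)"
    by (rule sum.reindex_bij_witness[of _ "\<lambda>(a, b, c). (b, a, c)" "\<lambda>(a, b, c). (b, a, c)"])
      (auto simp: triangle_def)
  have swap': "(\<Sum>(a, b, c)\<in>?T. pop b) = (\<Sum>(a, b, c)\<in>?T. pop c)"
    by (rule sum.reindex_bij_witness[of _ "\<lambda>(a, b, c). (a, c, b)" "\<lambda>(a, b, c). (a, c, b)"])
      (auto simp: triangle_def)
  have "{(u, i) \<in> triangle_word K ` ?T \<times> {1..3 * K}. u i = l} =
      (SIGMA u:triangle_word K ` ?T. {i \<in> {1..3 * K}. u i = l})" by auto
  then have "card {(u, i) \<in> triangle_word K ` ?T \<times> {1..3 * K}. u i = l} =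
      (\<Sum>u\<in>triangle_word K ` ?T. card {i \<in> {1..3 * K}. u i = l})"
    using finite_triangle by (simp add: card_SigmaI)
  also have "\<dots> = (\<Sum>p\<in>?T. ?n p)"
    by (simp only: sum.reindex[OF inj_on_triangle_word] o_def card_triangle_word_letter)
  also have "\<dots> = card ?T * K"
  proof -
    have three: "(\<Sum>q<3. f q) = f 0 + f 1 + f 2" for f :: "nat \<Rightarrow> nat"
      by (simp add: numeral_3_eq_3 numeral_2_eq_2)
    consider "l = 1" | "l = 2" | "l = 3" using assms by blast
    \<comment> \<open>The digit sums stay on both sides because subtraction on \<open>nat\<close>
      truncates.\<close>
    then have "(\<Sum>p\<in>?T. ?n p) + (\<Sum>(a, b, c)\<in>?T. pop a) = card ?T * K + (\<Sum>(a, b, c)\<in>?T. pop a)"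
    proof cases
      case 1
      have n: "?n (a, b, c) + pop c = K + pop a" for a b c
        using copop[of c] unfolding pop_def three 1 letter_eq_iff by simp
      have "(\<Sum>p\<in>?T. ?n p + (case p of (a, b, c) \<Rightarrow> pop c)) =
          (\<Sum>p\<in>?T. K + (case p of (a, b, c) \<Rightarrow> pop a))"
        by (rule sum.cong[OF refl]) (simp only: n split_paired_all prod.case)
      then have "(\<Sum>p\<in>?T. ?n p) + (\<Sum>(a, b, c)\<in>?T. pop c) = card ?T * K + (\<Sum>(a, b, c)\<in>?T. pop a)"
        by (simp only: sum.distrib sum_constant of_nat_id)
      then show ?thesis using swap swap' by linarith
    next
      case 2
      have n: "?n (a, b, c) + pop a = K + pop b" for a b c
        using copop[of a] unfolding pop_def three 2 letter_eq_iff by simp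
      have "(\<Sum>p\<in>?T. ?n p + (case p of (a, b, c) \<Rightarrow> pop a)) =
          (\<Sum>p\<in>?T. K + (case p of (a, b, c) \<Rightarrow> pop b))"
        by (rule sum.cong[OF refl]) (simp only: n split_paired_all prod.case)
      then have "(\<Sum>p\<in>?T. ?n p) + (\<Sum>(a, b, c)\<in>?T. pop a) = card ?T * K + (\<Sum>(a, b, c)\<in>?T. pop b)"
        by (simp only: sum.distrib sum_constant of_nat_id)
      then show ?thesis using swap swap' by linarith
    next
      case 3
      have n: "?n (a, b, c) + pop b = K + pop c" for a b c
        using copop[of b] unfolding pop_def three 3 letter_eq_iff by simp
      have "(\<Sum>p\<in>?T. ?n p + (case p of (a, b, c) \<Rightarrow> pop b)) =
          (\<Sum>p\<in>?T. K + (case p of (a, b, c) \<Rightarrow> pop c))"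
        by (rule sum.cong[OF refl]) (simp only: n split_paired_all prod.case)
      then have "(\<Sum>p\<in>?T. ?n p) + (\<Sum>(a, b, c)\<in>?T. pop b) = card ?T * K + (\<Sum>(a, b, c)\<in>?T. pop c)"
        by (simp only: sum.distrib sum_constant of_nat_id)
      then show ?thesis using swap swap' by linarith
    qed
    then show ?thesis by simp
  qed
  finally show ?thesis .
qed

section \<open>The capacity\<close>

definition max_USP_size :: "nat \<Rightarrow> nat" where
  "max_USP_size k = Max (card ` {U. strong_USP k U})"

lemma finite_strong_USPs: "finite {U. strong_USP k U}"
proof (rule finite_subset)
  show "{U. strong_USP k U} \<subseteq> Pow ({1..k} \<rightarrow>\<^sub>E {1, 2, 3})" by (auto simp only: strong_USP_def)
qed (simp add: finite_PiE)

lemma strong_USP_empty: "strong_USP k {}"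
  unfolding strong_USP_def by (simp add: permutes_empty)

lemma card_le_max_USP_size: "strong_USP k U \<Longrightarrow> card U \<le> max_USP_size k"
  unfolding max_USP_size_def using finite_strong_USPs by (intro Max_ge) auto

lemma max_USP_size_attained: "\<exists>U. strong_USP k U \<and> card U = max_USP_size k"
proof -
  have "max_USP_size k \<in> card ` {U. strong_USP k U}"
    unfolding max_USP_size_def using finite_strong_USPs strong_USP_empty by (intro Max_in) auto
  then show ?thesis by auto
qed

lemma max_USP_size_le: "max_USP_size k \<le> 3 ^ k"
proof -
  obtain U where U: "strong_USP k U" "card U = max_USP_size k"
    using max_USP_size_attained by blast
  have "card U \<le> card ({1..k} \<rightarrow>\<^sub>E {1, 2, 3::nat})"
    using U(1) by (intro card_mono) (simp_all add: strong_USP_def finite_PiE)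
  then show ?thesis using U(2) by (simp add: card_PiE numeral_3_eq_3)
qed

definition USP_rate :: "nat \<Rightarrow> real" where
  "USP_rate k = root k (real (max_USP_size k))"

lemma USP_rate_bounds: "0 \<le> USP_rate k" "USP_rate k \<le> 3"
proof -
  show "0 \<le> USP_rate k" by (simp add: USP_rate_def real_root_ge_zero)
  show "USP_rate k \<le> 3"
  proof (cases "k = 0")
    case False
    have "real (max_USP_size k) \<le> 3 ^ k"
      using max_USP_size_le[of k] by (metis of_nat_le_iff of_nat_numeral of_nat_power)
    then have "root k (real (max_USP_size k)) \<le> root k (3 ^ k)" using False by simp
    then show ?thesis using False by (simp add: USP_rate_def real_root_power_cancel)
  qed (simp add: USP_rate_def)
qed

lemma USP_rate_power: "0 < k \<Longrightarrow> USP_rate k ^ k = real (max_USP_size k)"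
  by (simp add: USP_rate_def)

text \<open>This settles that the greatest constant exists: a limit superior is attained along a
  subsequence, which is all that "infinitely many widths" asks for, and no larger constant can be
  approached infinitely often.\<close>

lemma strong_USP_capacity_eq_limsup: "ereal strong_USP_capacity = limsup (\<lambda>k. ereal (USP_rate k))"
proof -
  let ?u = "\<lambda>k. ereal (USP_rate k)"
  let ?P = "\<lambda>C. \<exists>\<delta> :: nat \<Rightarrow> real. \<delta> \<in> o(\<lambda>_. 1) \<and>
        infinite {k. \<exists>U. strong_USP k U \<and> real (card U) = (C - \<delta> k) ^ k}"
  have "limsup ?u \<le> ereal 3"
    by (rule Limsup_bounded) (simp add: USP_rate_bounds)
  moreover have "ereal 0 \<le> limsup ?u"
  proof -
    have "ereal 0 \<le> liminf ?u" by (rule Liminf_bounded) (simp add: USP_rate_bounds)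
    also have "\<dots> \<le> limsup ?u" by (rule Liminf_le_Limsup) simp
    finally show ?thesis .
  qed
  ultimately obtain L where L: "limsup ?u = ereal L" "0 \<le> L"
    by (cases "limsup ?u") auto
  have "?P L"
  proof -
    obtain s :: "nat \<Rightarrow> nat" where s: "strict_mono s" "(?u \<circ> s) \<longlonglongrightarrow> limsup ?u"
      using limsup_subseq_lim by blast
    then have lim: "(\<lambda>n. USP_rate (s n)) \<longlonglongrightarrow> L" unfolding L(1) by (simp add: o_def)
    \<comment> \<open>Along the subsequence the deviation turns \<open>L - \<delta> k\<close> into
      the exact rate; elsewhere it is 0, so that it still tends to 0 over all widths.\<close>
    define \<delta> where "\<delta> k = (if k \<in> range s then L - USP_rate k else 0)" for k
    have "\<delta> \<longlonglongrightarrow> 0"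
    proof (rule LIMSEQ_I)
      fix e :: real assume "0 < e"
      then obtain n0 where n0: "\<And>n. n0 \<le> n \<Longrightarrow> norm (USP_rate (s n) - L) < e"
        using LIMSEQ_D[OF lim] by blast
      have "norm (\<delta> k - 0) < e" if "s n0 \<le> k" for k
      proof (cases "k \<in> range s")
        case True
        then obtain n where n: "k = s n" by blast
        then have "n0 \<le> n" using that s(1) by (simp add: strict_mono_less_eq)
        from n0[OF this] show ?thesis by (simp add: \<delta>_def n abs_minus_commute)
      qed (simp add: \<delta>_def \<open>0 < e\<close>)
      then show "\<exists>k0. \<forall>k\<ge>k0. norm (\<delta> k - 0) < e" by blast
    qed
    then have "\<delta> \<in> o(\<lambda>_. 1)" by (intro smalloI_tendsto) simp_all
    moreover have "infinite {k. \<exists>U. strong_USP k U \<and> real (card U) = (L - \<delta> k) ^ k}"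
    proof
      assume "finite {k. \<exists>U. strong_USP k U \<and> real (card U) = (L - \<delta> k) ^ k}"
      moreover have "range s - {0} \<subseteq> {k. \<exists>U. strong_USP k U \<and> real (card U) = (L - \<delta> k) ^ k}"
      proof
        fix k assume k: "k \<in> range s - {0}"
        obtain U where "strong_USP k U" "card U = max_USP_size k"
          using max_USP_size_attained by blast
        moreover have "(L - \<delta> k) ^ k = real (max_USP_size k)"
          using k USP_rate_power[of k] by (simp add: \<delta>_def)
        ultimately show "k \<in> {k. \<exists>U. strong_USP k U \<and> real (card U) = (L - \<delta> k) ^ k}" by auto
      qed
      ultimately have "finite (range s - {0})" by (rule rev_finite_subset)
      then have "finite (range s)" by simp
      then show False using s(1) by (simp add: finite_image_iff strict_mono_imp_inj_on)
    qed
    ultimately show ?thesis by blast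
  qed
  moreover have "C \<le> L" if P: "?P C" for C
  proof (rule ccontr)
    assume "\<not> C \<le> L"
    then have less: "L < C" by simp
    obtain \<delta> :: "nat \<Rightarrow> real" where \<delta>: "\<delta> \<in> o(\<lambda>_. 1)"
      and inf: "infinite {k. \<exists>U. strong_USP k U \<and> real (card U) = (C - \<delta> k) ^ k}"
      using P by blast
    have "\<delta> \<longlonglongrightarrow> 0" using smalloD_tendsto[OF \<delta>] by simp
    moreover have "0 < (C - L) / 2" using less by simp
    \<comment> \<open>The midpoint of \<open>L\<close> and \<open>C\<close> separates the two sides:
      eventually the rate lies below it and \<open>C - \<delta> k\<close> above it.\<close>
    ultimately have ev1: "\<forall>\<^sub>F k in sequentially. \<delta> k < (C - L) / 2"
      by (rule order_tendstoD(2))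
    have "limsup ?u < ereal ((L + C) / 2)" using L less by simp
    then have ev2: "\<forall>\<^sub>F k in sequentially. ?u k < ereal ((L + C) / 2)"
      by (rule Limsup_lessD)
    have "\<forall>\<^sub>F k in sequentially. \<not> (\<exists>U. strong_USP k U \<and> real (card U) = (C - \<delta> k) ^ k)"
      using ev1 ev2 eventually_gt_at_top[of 0]
    proof eventually_elim
      case (elim k)
      show ?case
      proof
        assume "\<exists>U. strong_USP k U \<and> real (card U) = (C - \<delta> k) ^ k"
        then obtain U where U: "strong_USP k U" "real (card U) = (C - \<delta> k) ^ k" by blast
        have "(C - \<delta> k) ^ k \<le> USP_rate k ^ k"
          using card_le_max_USP_size[OF U(1)] U(2) USP_rate_power[OF elim(3)] by simp
        moreover have "USP_rate k < C - \<delta> k"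
          using elim(1,2) by (simp add: field_simps)
        then have "USP_rate k ^ k < (C - \<delta> k) ^ k"
          using USP_rate_bounds(1)[of k] elim(3) by (intro power_strict_mono) auto
        ultimately show False by simp
      qed
    qed
    then have "finite {k. \<exists>U. strong_USP k U \<and> real (card U) = (C - \<delta> k) ^ k}"
      by (simp add: eventually_cofinite cofinite_eq_sequentially[symmetric])
    then show False using inf by blast
  qed
  ultimately have "Greatest ?P = L" by (rule Greatest_equality)
  then show ?thesis by (simp only: strong_USP_capacity_def L(1))
qed

section \<open>The lower bound for the capacity\<close>

lemma card_triangle_ge: "4 ^ K \<le> 2 * card (triangle K)"
proof -
  have "(4::nat) ^ K = 2 ^ K * 2 ^ K" by (simp flip: power_mult_distrib)
  then show ?thesis by (simp add: card_triangle)
qed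

text \<open>Only the widths \<open>3 * j\<close> matter. A puzzle with at least 4^j / 2 words has
  rate at least 2 to the power 2/3 - 1/(3 j), and the loss caused by the factor 1/2 disappears in
  the limit.\<close>

theorem strong_USP_capacity_ge: "2 powr (2 / 3) \<le> strong_USP_capacity"
proof (rule ccontr)
  assume "\<not> ?thesis"
  then have less: "strong_USP_capacity < 2 powr (2 / 3)" by simp
  define c where "c = (strong_USP_capacity + 2 powr (2 / 3)) / 2"
  have "limsup (\<lambda>k. ereal (USP_rate k)) < ereal c"
    using less by (simp add: strong_USP_capacity_eq_limsup[symmetric] c_def)
  then have ev: "\<forall>\<^sub>F k in sequentially. ereal (USP_rate k) < ereal c" by (rule Limsup_lessD)
  have mono: "filterlim (\<lambda>j::nat. 3 * j) sequentially sequentially"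
    by (rule filterlim_subseq) (simp add: strict_mono_def)
  have "\<forall>\<^sub>F j in sequentially. 2 powr (2 / 3 - 1 / 3 * (1 / real j)) \<le> c"
    using eventually_compose_filterlim[OF ev mono] eventually_gt_at_top[of 0]
  proof eventually_elim
    case (elim j)
    have "2 powr (2 / 3 - 1 / 3 * (1 / real j)) = root (3 * j) (2 powr (2 * real j - 1))"
    proof -
      have "(2 / 3 - 1 / 3 * (1 / real j)) * real (3 * j) = 2 * real j - 1"
        using elim(2) by (simp add: algebra_simps)
      then have "(2 powr (2 / 3 - 1 / 3 * (1 / real j))) ^ (3 * j) = 2 powr (2 * real j - 1)"
        by (simp only: powr_realpow[symmetric] powr_powr powr_gt_zero)
      then show ?thesis using elim(2) by (intro real_root_pos_unique[symmetric]) auto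
    qed
    also have "\<dots> \<le> USP_rate (3 * j)"
    proof -
      have "2 powr (2 * real j - 1) = (4 ^ j) / (2::real)"
        by (simp add: powr_diff powr_realpow[of 2 "2 * j", simplified] power_mult)
      also have "(4::real) ^ j = real (4 ^ j)" by simp
      also have "real (4 ^ j) \<le> real (2 * card (triangle j))"
        using card_triangle_ge by (simp only: of_nat_le_iff)
      also have "card (triangle j) \<le> max_USP_size (3 * j)"
        using card_le_max_USP_size[OF strong_USP_triangle] by (simp add: card_triangle_words)
      finally have "2 powr (2 * real j - 1) \<le> real (max_USP_size (3 * j))" by simp
      then show ?thesis unfolding USP_rate_def using elim(2) by simp
    qed
    finally show ?case using elim(1) by simp
  qed
  moreover have "(\<lambda>j. 2 powr (2 / 3 - 1 / 3 * (1 / real j))) \<longlonglongrightarrow> 2 powr (2 / 3 - 1 / 3 * 0)"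
    by (intro tendsto_intros lim_1_over_n) simp
  ultimately have "2 powr (2 / 3) \<le> c"
    using tendsto_upperbound[of "\<lambda>j. 2 powr (2 / 3 - 1 / 3 * (1 / real j))"] by simp
  then show False using less by (simp add: c_def)
qed

section \<open>The exponent\<close>

text \<open>A crude form of Stirling's bound with 3 in place of e. The weaker constant costs a
  factor per unit of \<open>n\<close>, which a large \<open>K\<close> outweighs, since the gain is
  exponential in \<open>n * K\<close>.\<close>

lemma power_self_le_fact: "real n ^ n \<le> 3 ^ n * fact n"
proof (induction n)
  case (Suc n)
  have "real (Suc n) ^ n \<le> 3 * real n ^ n"
  proof (cases "n = 0")
    case False
    have "(1 + 1 / real n) ^ n \<le> exp 1"
      using exp_ge_one_plus_x_over_n_power_n[of n 1] False by simp
    then have "(1 + 1 / real n) ^ n \<le> 3" using exp_le by linarith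
    then have "(1 + 1 / real n) ^ n * real n ^ n \<le> 3 * real n ^ n" by (intro mult_right_mono) simp_all
    moreover have "(1 + 1 / real n) ^ n * real n ^ n = real (Suc n) ^ n"
      using False by (simp add: power_mult_distrib[symmetric] field_simps)
    ultimately show ?thesis by simp
  qed simp
  also have "\<dots> \<le> 3 * (3 ^ n * fact n)" using Suc by simp
  finally have "real (Suc n) * real (Suc n) ^ n \<le> real (Suc n) * (3 * (3 ^ n * fact n))"
    by (intro mult_left_mono) simp_all
  then show ?case by (simp add: algebra_simps)
qed simp

text \<open>The fraction 119/48 lies between log 54 / log 5 and 2.48, and raising to the power 48
  leaves a comparison of integers.\<close>

lemma fifty_four_less: "54 < (5::real) powr (119 / 48)"
proof (rule power_less_imp_less_base)
  have "(5 powr (119 / 48)) ^ 48 = (5::real) ^ 119"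
    by (simp add: powr_realpow[symmetric] powr_powr)
  then show "54 ^ 48 < ((5::real) powr (119 / 48)) ^ 48" by simp
qed simp

text \<open>For \<open>n = card (triangle K)\<close>, the bounds \<open>n! \<ge> (n / 3) ^ n\<close> and \<open>n \<ge> 4 ^ K / 2\<close> give
  \<open>6 ^ (3 n K) / n! \<le> (6 * 54 ^ K) ^ n\<close>, where \<open>54 = 6\<^sup>3 / 4\<close>.\<close>

lemma exists_batch_number:
  obtains K \<rho> :: nat where "6 ^ (card (triangle K) * (3 * K)) \<le> \<rho> * fact (card (triangle K))"
    and "(5 ^ (card (triangle K) * K))\<^sup>2 + 1 \<le> \<rho>"
    and "real \<rho> \<le> real (5 ^ (card (triangle K) * K)) powr (119 / 48)"
    and "0 < card (triangle K) * K"
proof -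
  define q :: real where "q = 5 powr (119 / 48)"
  have q: "54 < q" using fifty_four_less by (simp add: q_def)
  \<comment> \<open>The constant is 12 = 2 * 3 * 2: one factor 2 from 4^K / 2, the 3 from the
    factorial bound, and a further 2 for rounding \<rho> down.\<close>
  then obtain K where K: "12 < (q / 54) ^ K" using real_arch_pow[of "q / 54" 12] by auto
  then have K0: "0 < K" by (intro gr0I) auto
  have K12: "12 * 54 ^ K \<le> q ^ K" using K by (simp add: power_divide field_simps)
  define n where "n = card (triangle K)"
  have n_ge: "4 ^ K / 2 \<le> real n"
  proof -
    have "real (4 ^ K) \<le> real (2 * card (triangle K))"
      using card_triangle_ge[of K] by (simp only: of_nat_le_iff)
    then show ?thesis by (simp add: n_def)
  qed
  have "0 < (4::real) ^ K / 2" by simp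
  then have "0 < real n" using n_ge by linarith
  then have n0: "0 < n" by simp
  define e where "e = n * K"
  have e0: "0 < e" using n0 K0 by (simp add: e_def)
  define x where "x = real (5 ^ e) powr (119 / 48)"
  have x: "x = q ^ e"
    unfolding x_def q_def by (simp add: powr_realpow[symmetric] powr_powr mult.commute)
  \<comment> \<open>The largest integer that the target exponent permits.\<close>
  define \<rho> where "\<rho> = nat \<lfloor>x\<rfloor>"
  have x0: "0 \<le> x" by (simp add: x_def)
  have \<rho>: "real \<rho> \<le> x" "x < real \<rho> + 1" using x0 by (simp_all add: \<rho>_def) 
  have "(4::real) ^ e / 2 ^ n \<le> 3 ^ n * fact n"
  proof -
    have "(4::real) ^ e / 2 ^ n = (4 ^ K / 2) ^ n"
      by (simp only: e_def power_divide mult.commute[of n K] power_mult)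
    also have "\<dots> \<le> real n ^ n" using n_ge by (intro power_mono) simp_all
    also have "\<dots> \<le> 3 ^ n * fact n" by (rule power_self_le_fact)
    finally show ?thesis .
  qed
  then have four: "(4::real) ^ e \<le> 6 ^ n * fact n"
  proof -
    assume "(4::real) ^ e / 2 ^ n \<le> 3 ^ n * fact n"
    then have "(4::real) ^ e \<le> 2 ^ n * 3 ^ n * fact n" by (simp add: field_simps)
    also have "(2::real) ^ n * 3 ^ n = 6 ^ n" unfolding power_mult_distrib[symmetric] by simp
    finally show ?thesis .
  qed
  let ?y = "(6 * 54 ^ K :: real) ^ n"
  have y1: "1 \<le> ?y"
  proof (rule one_le_power)
    have "1 \<le> (54::real) ^ K" by simp
    then show "1 \<le> (6 * 54 ^ K :: real)" by linarith
  qed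
  have "?y + 1 \<le> 2 * ?y" using y1 by simp
  also have "\<dots> \<le> 2 ^ n * ?y"
  proof (rule mult_right_mono)
    show "(2::real) \<le> 2 ^ n" using n0 self_le_power[of "2::real" n] by simp
  qed simp
  also have "\<dots> = (12 * 54 ^ K) ^ n" unfolding power_mult_distrib[symmetric] by simp
  also have "\<dots> \<le> (q ^ K) ^ n" using K12 by (intro power_mono) simp_all
  also have "\<dots> = x" by (simp only: x e_def mult.commute[of n K] power_mult)
  finally have y_le: "?y \<le> real \<rho>" using \<rho> by linarith
  have exponent: "n * (3 * K) = 3 * e" by (simp add: e_def)
  have "real (6 ^ (n * (3 * K))) = (6 ^ 3) ^ e"
    by (simp only: exponent power_mult of_nat_power of_nat_numeral)
  also have "\<dots> = (216::real) ^ e" by simp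
  also have "\<dots> = 54 ^ e * (4::real) ^ e" unfolding power_mult_distrib[symmetric] by simp
  also have "\<dots> \<le> 54 ^ e * (6 ^ n * fact n)" using four by (intro mult_left_mono) simp_all
  also have "(54::real) ^ e = (54 ^ K) ^ n"
    by (simp only: e_def mult.commute[of n K] power_mult)
  also have "(54 ^ K) ^ n * (6 ^ n * fact n) = ?y * fact n"
    by (simp add: power_mult_distrib mult_ac)
  also have "\<dots> \<le> real \<rho> * fact n" using y_le by (intro mult_right_mono) simp_all
  also have "\<dots> = real (\<rho> * fact n)" by simp
  finally have R: "6 ^ (n * (3 * K)) \<le> \<rho> * fact n" unfolding of_nat_le_iff .
  \<comment> \<open>The room between 25 and 54 accommodates both the summand 1 and the
    rounding.\<close>
  have "real ((5 ^ e)\<^sup>2 + 1) + 1 \<le> 2 * 25 ^ e"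
  proof -
    have "(25::real) \<le> 25 ^ e" using e0 self_le_power[of "25::real" e] by simp
    moreover have "((5::nat) ^ e)\<^sup>2 = (5\<^sup>2) ^ e"
      by (simp only: power_mult[symmetric] mult.commute)
    ultimately show ?thesis by simp
  qed
  also have "\<dots> \<le> 2 ^ e * (25::real) ^ e"
    using e0 self_le_power[of "2::real" e] by (intro mult_right_mono) simp_all
  also have "\<dots> = 50 ^ e" unfolding power_mult_distrib[symmetric] by simp
  also have "\<dots> \<le> x" unfolding x using q by (intro power_mono) simp_all
  finally have "real ((5 ^ e)\<^sup>2 + 1) \<le> real \<rho>" using \<rho> by linarith
  then have "(5 ^ e)\<^sup>2 + 1 \<le> \<rho>" by (simp only: of_nat_le_iff)
  with R \<rho>(1) e0 show ?thesis unfolding n_def e_def x_def by (intro that[of K \<rho>])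
qed

lemma matrix_mult_in_ops_powr:
  obtains ops and c :: real where "\<And>n. matrix_mult_in_ops n (ops n)"
    and "\<And>n. 1 \<le> n \<Longrightarrow> real (ops n) \<le> c * real n powr (119 / 48)"
proof -
  obtain K \<rho> :: nat where R: "6 ^ (card (triangle K) * (3 * K)) \<le> \<rho> * fact (card (triangle K))"
    and \<rho>: "(5 ^ (card (triangle K) * K))\<^sup>2 + 1 \<le> \<rho>"
    and \<rho>_le: "real \<rho> \<le> real (5 ^ (card (triangle K) * K)) powr (119 / 48)"
    and pos: "0 < card (triangle K) * K"
    by (rule exists_batch_number)
  define N :: nat where "N = 5 ^ (card (triangle K) * K)"
  define r :: nat where "r = fact (card (triangle K))"
  define R' :: nat where "R' = 6 ^ (card (triangle K) * (3 * K))"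
  obtain \<alpha> \<beta> \<gamma> :: "nat \<Rightarrow> nat \<times> nat \<times> nat \<Rightarrow> complex" where alg: "bilinear_algorithm r N R' \<alpha> \<beta> \<gamma>"
    using bilinear_algorithm_of_strong_USP[OF strong_USP_triangle _ count_triangle_letters, of 6 K]
    unfolding card_triangle_words by (auto simp: r_def N_def R'_def)
  have r0: "0 < r" by (simp add: r_def)
  have N: "2 \<le> N"
    using pos self_le_power[of "5::nat" "card (triangle K) * K"] by (simp add: N_def)
  define c0 where "c0 = r + 6 * R' * r * N\<^sup>2"
  have in_ops: "\<exists>m \<le> c0 * \<rho> ^ s. matrix_mult_in_ops n m" if "n \<le> N ^ s" for n s
    unfolding c0_def
    by (rule matrix_mult_in_ops_power[OF alg r0 _ _ that]) (use R \<rho> in \<open>simp_all add: r_def R'_def N_def\<close>)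
  define c where "c = real c0 * real N powr (119 / 48)"
  have "\<exists>m. matrix_mult_in_ops n m \<and> (1 \<le> n \<longrightarrow> real m \<le> c * real n powr (119 / 48))" for n
  proof -
    have ex: "\<exists>s. n \<le> N ^ s"
    proof
      have "n < 2 ^ n" by (rule less_exp)
      also have "\<dots> \<le> N ^ n" using N by (intro power_mono) simp_all
      finally show "n \<le> N ^ n" by simp
    qed
    \<comment> \<open>By minimality the padded size exceeds \<open>n\<close> by at most a factor
      \<open>N\<close>, which only changes the constant \<open>c\<close>.\<close>
    define s where "s = (LEAST s. n \<le> N ^ s)"
    have s: "n \<le> N ^ s" unfolding s_def using ex by (rule LeastI_ex)
    from in_ops[OF this] obtain m where m: "m \<le> c0 * \<rho> ^ s" "matrix_mult_in_ops n m" by blast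
    have "real m \<le> c * real n powr (119 / 48)" if "1 \<le> n"
    proof -
      have "N ^ s \<le> N * n"
      proof (cases s)
        case 0
        then show ?thesis using N that by simp
      next
        case (Suc s')
        then have "\<not> n \<le> N ^ s'" unfolding s_def by (intro not_less_Least) simp
        then show ?thesis using Suc by simp
      qed
      have "real m \<le> real (c0 * \<rho> ^ s)" using m(1) by (simp only: of_nat_le_iff)
      also have "\<dots> = real c0 * real \<rho> ^ s" by simp
      also have "\<dots> \<le> real c0 * (real N powr (119 / 48)) ^ s"
        using \<rho>_le by (intro mult_left_mono power_mono) (simp_all add: N_def)
      also have "(real N powr (119 / 48)) ^ s = real (N ^ s) powr (119 / 48)"
        using N by (simp add: powr_powr powr_realpow[symmetric] mult.commute)
      also have "\<dots> \<le> real (N * n) powr (119 / 48)"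
      proof (rule powr_mono2)
        show "real (N ^ s) \<le> real (N * n)" using \<open>N ^ s \<le> N * n\<close> by (simp only: of_nat_le_iff)
      qed simp_all
      also have "\<dots> = real N powr (119 / 48) * real n powr (119 / 48)"
        by (simp add: powr_mult)
      finally show ?thesis by (simp add: c_def mult_left_mono mult.assoc)
    qed
    then show ?thesis using m(2) by blast
  qed
  then have "\<exists>ops. \<forall>n. matrix_mult_in_ops n (ops n) \<and> (1 \<le> n \<longrightarrow> real (ops n) \<le> c * real n powr (119 / 48))"
    by (rule choice[OF allI])
  then obtain ops where "\<forall>n. matrix_mult_in_ops n (ops n) \<and> (1 \<le> n \<longrightarrow> real (ops n) \<le> c * real n powr (119 / 48))"
    by (rule exE)
  then show ?thesis by (intro that[of ops c]) simp_all
qed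

section \<open>Existence of the least exponent\<close>

text \<open>Serves to exclude negative exponents. With no instruction an output is a constant or an
  entry of one of the two matrices. The products 1 * 1, 1 * 0 and 0 * 1 refute this, because each
  such output takes the same value on 1 * 1 as on one of the other two.\<close>

lemma not_matrix_mult_in_ops_0:
  assumes "1 \<le> n"
  shows "\<not> matrix_mult_in_ops n 0"
proof
  assume "matrix_mult_in_ops n 0"
  then obtain out where out: "\<And>A B. A \<in> carrier_mat n n \<Longrightarrow> B \<in> carrier_mat n n \<Longrightarrow>
      operand_value A B [] (out 0 0) = Some ((A * B) $$ (0, 0))"
    using assms unfolding matrix_mult_in_ops_def computes_matrix_product_def by fastforce
  have 11: "operand_value (1\<^sub>m n) (1\<^sub>m n) [] (out 0 0) = Some 1"
    using out[of "1\<^sub>m n" "1\<^sub>m n"] assms by simp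
  have 10: "operand_value (1\<^sub>m n) (0\<^sub>m n n) [] (out 0 0) = Some 0"
    using out[of "1\<^sub>m n" "0\<^sub>m n n"] assms by simp
  have 01: "operand_value (0\<^sub>m n n) (1\<^sub>m n) [] (out 0 0) = Some 0"
    using out[of "0\<^sub>m n n" "1\<^sub>m n"] assms by simp
  show False
    using 11 10 01 by (cases "out 0 0") (auto split: if_splits)
qed

text \<open>The margin \<open>\<epsilon>\<close> in the definition makes the infimum of the
  admissible exponents admissible itself, so the least one exists as soon as the set is bounded
  below.\<close>

theorem matrix_mult_exponent_le: "matrix_mult_exponent \<le> 119 / 48"
proof -
  let ?Q = "\<lambda>w. \<forall>\<epsilon>>0. \<exists>ops :: nat \<Rightarrow> nat. (\<forall>n. matrix_mult_in_ops n (ops n)) \<and>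
        (\<lambda>n. real (ops n)) \<in> O(\<lambda>n. real n powr (w + \<epsilon>))"
  define W where "W = {w. ?Q w}"
  have Q: "?Q (119 / 48)"
  proof (intro allI impI)
    fix \<epsilon> :: real assume \<epsilon>: "0 < \<epsilon>"
    obtain ops and c :: real where ops: "\<And>n. matrix_mult_in_ops n (ops n)"
      and le: "\<And>n. 1 \<le> n \<Longrightarrow> real (ops n) \<le> c * real n powr (119 / 48)"
      by (rule matrix_mult_in_ops_powr) (rule that)
    have "(\<lambda>n. real (ops n)) \<in> O(\<lambda>n. real n powr (119 / 48 + \<epsilon>))"
    proof (rule bigoI[of _ "\<bar>c\<bar>"])
      show "\<forall>\<^sub>F n in sequentially. norm (real (ops n)) \<le> \<bar>c\<bar> * norm (real n powr (119 / 48 + \<epsilon>))"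
        using eventually_ge_at_top[of 1]
      proof eventually_elim
        case (elim n)
        have "real (ops n) \<le> c * real n powr (119 / 48)" by (rule le[OF elim])
        also have "\<dots> \<le> \<bar>c\<bar> * real n powr (119 / 48)" by (intro mult_right_mono) simp_all
        also have "\<dots> \<le> \<bar>c\<bar> * real n powr (119 / 48 + \<epsilon>)"
          using elim \<epsilon> by (intro mult_left_mono powr_mono) simp_all
        finally show ?case by simp
      qed
    qed
    then show "\<exists>ops :: nat \<Rightarrow> nat. (\<forall>n. matrix_mult_in_ops n (ops n)) \<and>
        (\<lambda>n. real (ops n)) \<in> O(\<lambda>n. real n powr (119 / 48 + \<epsilon>))"
      using ops by blast
  qed
  then have ne: "W \<noteq> {}" "119 / 48 \<in> W" by (auto simp: W_def)
  have lower: "0 \<le> w" if w: "w \<in> W" for w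
  proof (rule ccontr)
    assume neg: "\<not> 0 \<le> w"
    \<comment> \<open>Half of \<open>- w\<close> as margin leaves the negative exponent
      \<open>w / 2\<close>, so the number of operations would tend to 0 and hence be 0 for large
      \<open>n\<close>.\<close>
    then have "0 < - w / 2" by simp
    then obtain ops :: "nat \<Rightarrow> nat" where ops: "\<And>n. matrix_mult_in_ops n (ops n)"
      and O: "(\<lambda>n. real (ops n)) \<in> O(\<lambda>n. real n powr (w + (- w / 2)))"
      using CollectD[OF w[unfolded W_def]] by blast
    have "w + (- w / 2) < 0" using neg by simp
    then have "(\<lambda>n. real n powr (w + (- w / 2))) \<longlonglongrightarrow> 0"
      by (intro tendsto_neg_powr filterlim_real_sequentially)
    then have "(\<lambda>n. real n powr (w + (- w / 2))) \<in> o(\<lambda>_. 1)"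
      by (intro smalloI_tendsto) simp_all
    with O have "(\<lambda>n. real (ops n)) \<in> o(\<lambda>_. 1)" by (rule landau_o.big_small_trans)
    from smalloD_tendsto[OF this] have "(\<lambda>n. real (ops n)) \<longlonglongrightarrow> 0" by simp
    then have "\<forall>\<^sub>F n in sequentially. real (ops n) < 1" by (rule order_tendstoD(2)) simp
    then have "\<forall>\<^sub>F n in sequentially. False"
      using eventually_ge_at_top[of 1]
    proof eventually_elim
      case (elim n)
      then show ?case using ops[of n] not_matrix_mult_in_ops_0[of n] by simp
    qed
    then show False by simp
  qed
  then have bdd: "bdd_below W" by (intro bdd_belowI)
  have "?Q (Inf W)"
  proof (intro allI impI)
    fix \<epsilon> :: real assume "0 < \<epsilon>"
    then have "Inf W < Inf W + \<epsilon>" by simp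
    \<comment> \<open>Part of \<open>\<epsilon>\<close> is spent on reaching some \<open>w\<close>
      in \<open>W\<close>, and the remainder serves as the margin for that \<open>w\<close>.\<close>
    then obtain w where w: "w \<in> W" "w < Inf W + \<epsilon>"
      using cInf_less_iff[OF ne(1) bdd] by blast
    have pos: "0 < Inf W + \<epsilon> - w" using w(2) by simp
    have "?Q w" using w(1) unfolding W_def by (rule CollectD)
    from this[rule_format, OF pos] show "\<exists>ops :: nat \<Rightarrow> nat. (\<forall>n. matrix_mult_in_ops n (ops n)) \<and>
        (\<lambda>n. real (ops n)) \<in> O(\<lambda>n. real n powr (Inf W + \<epsilon>))"
      by (simp only: add_diff_cancel_left' add.commute[of w] diff_add_cancel)
  qed
  then have "Least ?Q = Inf W"
    by (rule Least_equality) (rule cInf_lower[OF _ bdd], simp add: W_def)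
  then have "matrix_mult_exponent = Inf W" by (simp only: matrix_mult_exponent_def)
  also have "\<dots> \<le> 119 / 48" by (rule cInf_lower[OF ne(2) bdd])
  finally show ?thesis .
qed

theorem mainTheorem2:
  "strong_USP_capacity \<ge> 2 powr (2 / 3) \<and> matrix_mult_exponent < 2.48"
  using strong_USP_capacity_ge matrix_mult_exponent_le by simp

end
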